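(* Let $F(z_1,z_2)=\sum_{j\in\mathbb Z}f_j(z_1)z_2^j$ be a function in $H^2(D'_\beta)$. For $(\zeta_1,\zeta_2)\in\partial D'_\beta$ define $$\widetilde F(\zeta_1,\zeta_2)=\sum_{j\in\mathbb Z}\widetilde f_j(\zeta_1)\zeta_2^j .$$ Then $F_{t,s}\to\widetilde F$ in $L^2(\partial D'_\beta)$ as $(t,s)\to(\frac\pi2,\beta-\frac\pi2)$, and $\|F\|_{H^2(D'_\beta)}=\|\widetilde F\|_{L^2(\partial D'_\beta)}$.
   Context: Fix $\beta>\frac{\pi}{2}$, and let $\mathbb T=\mathbb R/\mathbb Z$. Let $$D'_\beta=\{(z_1,z_2)\in\mathbb C^2: |\operatorname{Im}z_1-\log|z_2|^2|<\tfrac{\pi}{2},\ |\log|z_2|^2|<\beta-\tfrac{\pi}{2}\}.$$ Put $(\eta_1,\eta_2,\eta_3,\eta_4)=(\beta,\beta-\pi,-\beta,-(\beta-\pi))$ and $(\sigma_1,\sigma_2,\sigma_3,\sigma_4)=(1,1,-1,-1)$. The distinguished boundary is $\partial D'_\beta=\bigcup_{\ell=1}^4E_\ell$, $E_\ell=\{(x+i\eta_\ell,e^{\frac{\sigma_\ell}2(\beta-\frac\pi2)}e^{2\pi i\theta}):x\in\mathbb R,\theta\in\mathbb T\}$, each $E_\ell$ identified with $\mathbb R\times\mathbb T$. A function on $\partial D'_\beta$ is a vector of four functions on $\mathbb R\times\mathbb T$, with $\|\varphi\|^2_{L^2(\partial D'_\beta)}=\sum_\ell\|\varphi_\ell\|^2_{L^2(\mathbb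 R\times\mathbb T)}$. For $F$ holomorphic on $D'_\beta$ and $(t,s)\in[0,\frac\pi2)\times[0,\beta-\frac\pi2)$, put $F_{t,s}=(F_{1,t,s},\dots,F_{4,t,s})$ with $F_{1,t,s}(x,\theta)=F(x+i(s+t),e^{s/2}e^{2\pi i\theta})$, $F_{2,t,s}(x,\theta)=F(x+i(s-t),e^{s/2}e^{2\pi i\theta})$, $F_{3,t,s}(x,\theta)=F(x-i(s+t),e^{-s/2}e^{2\pi i\theta})$, $F_{4,t,s}(x,\theta)=F(x-i(s-t),e^{-s/2}e^{2\pi i\theta})$. $H^2(D'_\beta)$ is the space of holomorphic $F$ with $\|F\|^2_{H^2(D'_\beta)}=\sup_{(t,s)}\|F_{t,s}\|^2_{L^2(\partial D'_\beta)}<\infty$. Let $S_\beta=\{x+iy:|y|<\beta\}$ and let $H^2(S_\beta)$ be the space of holomorphic $f$ on $S_\beta$ with $\sup_{0\le y<\beta}\big[\int_{\mathbb R}|f(x+iy)|^2dx+\int_{\mathbb R}|f(x-iy)|^2dx\big]<\infty$. Every $F\in H^2(D'_\beta)$ has a pointwise convergent expansion $F(z_1,z_2)=\sum_{j\in\mathbb Z}f_j(z_1)z_2^j$ with $f_j\in H^2(S_\beta)$ and $f_j(z_1)z_2^j=\int_0^1F(z_1,e^{2\pi i\theta}z_2)e^{-2\pi ij\theta}d\theta$. For $f\in H^2(S_\beta)$, $\widetilde f(x\pm i\beta)$ is the $L^2(\mathbb R)$ limit of $f(x+iy)$ as $y\to\pm\beta$ (it exists); for $|\operatorname{Im}\zeta_1|<\beta$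 (as on $E_2,E_4$) $\widetilde f(\zeta_1)=f(\zeta_1)$. The series defining $\widetilde F$ is understood as convergent in $L^2(\partial D'_\beta)$. *)

theory Defs
  imports "HOL-Complex_Analysis.Complex_Analysis"
begin

definition L2_sq :: "'a measure \<Rightarrow> ('a \<Rightarrow> complex) \<Rightarrow> ennreal" where
  "L2_sq M u = (\<integral>\<^sup>+x. ennreal ((cmod (u x))\<^sup>2) \<partial>M)"

definition L2 :: "'a measure \<Rightarrow> ('a \<Rightarrow> complex) set" where
  "L2 M = {u \<in> borel_measurable M. L2_sq M u < \<infinity>}"

definition L2_tendsto ::
  "'a measure \<Rightarrow> ('i \<Rightarrow> 'a \<Rightarrow> complex) \<Rightarrow> ('a \<Rightarrow> complex) \<Rightarrow> 'i filter \<Rightarrow> bool" where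
  "L2_tendsto M u g A \<longleftrightarrow> g \<in> L2 M \<and> (\<forall>\<^sub>F i in A. u i \<in> L2 M) \<and>
     ((\<lambda>i. L2_sq M (\<lambda>x. u i x - g x)) \<longlongrightarrow> 0) A"

text \<open>Holomorphy in two variables is complex Frechet differentiability: the real derivative
  exists and is complex linear.\<close>

definition holomorphic2_on :: "(complex \<times> complex \<Rightarrow> complex) \<Rightarrow> (complex \<times> complex) set \<Rightarrow> bool" where
  "holomorphic2_on F D \<longleftrightarrow>
     (\<forall>z\<in>D. \<exists>a b. (F has_derivative (\<lambda>h. a * fst h + b * snd h)) (at z))"

text \<open>Since \<open>ln 0 = 0\<close>, the condition \<open>z2 \<noteq> 0\<close> has to be explicit.\<close>

definition worm :: "real \<Rightarrow> (complex \<times> complex) set" where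
  "worm \<beta> = {(z1, z2). z2 \<noteq> 0 \<and> \<bar>Im z1 - ln ((cmod z2)\<^sup>2)\<bar> < pi / 2 \<and>
     \<bar>ln ((cmod z2)\<^sup>2)\<bar> < \<beta> - pi / 2}"

text \<open>The circle \<open>\<real>/\<int>\<close> is represented by its fundamental domain \<open>[0, 1)\<close>.
  A function on the distinguished boundary is a family of four functions
  of \<open>(x, \<theta>)\<close>, indexed by the components \<open>E\<^sub>1, \<dots>, E\<^sub>4\<close>.\<close>

definition cylinder :: "(real \<times> real) measure" where
  "cylinder = lborel \<Otimes>\<^sub>M restrict_space lborel {0..<1}"

datatype edge = E1 | E2 | E3 | E4

type_synonym bdry_fun = "edge \<Rightarrow> real \<times> real \<Rightarrow> complex"

fun edge_height :: "real \<Rightarrow> edge \<Rightarrow> real" where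
  "edge_height \<beta> E1 = \<beta>"
| "edge_height \<beta> E2 = \<beta> - pi"
| "edge_height \<beta> E3 = - \<beta>"
| "edge_height \<beta> E4 = - (\<beta> - pi)"

fun edge_sign :: "edge \<Rightarrow> real" where
  "edge_sign E1 = 1"
| "edge_sign E2 = 1"
| "edge_sign E3 = - 1"
| "edge_sign E4 = - 1"

fun bdry_point :: "real \<Rightarrow> edge \<Rightarrow> real \<times> real \<Rightarrow> complex \<times> complex" where
  "bdry_point \<beta> l (x, \<theta>) =
     (Complex x (edge_height \<beta> l),
      complex_of_real (exp (edge_sign l / 2 * (\<beta> - pi / 2))) * cis (2 * pi * \<theta>))"

definition bdry_sq :: "bdry_fun \<Rightarrow> ennreal" where
  "bdry_sq G = (\<Sum>l\<in>{E1, E2, E3, E4}. L2_sq cylinder (G l))"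

definition bdry_norm :: "bdry_fun \<Rightarrow> real" where
  "bdry_norm G = sqrt (enn2real (bdry_sq G))"

definition bdry_L2 :: "bdry_fun set" where
  "bdry_L2 = {G. \<forall>l. G l \<in> L2 cylinder}"

definition bdry_tendsto :: "('i \<Rightarrow> bdry_fun) \<Rightarrow> bdry_fun \<Rightarrow> 'i filter \<Rightarrow> bool" where
  "bdry_tendsto U G A \<longleftrightarrow> G \<in> bdry_L2 \<and> (\<forall>\<^sub>F i in A. U i \<in> bdry_L2) \<and>
     ((\<lambda>i. bdry_sq (\<lambda>l p. U i l p - G l p)) \<longlongrightarrow> 0) A"

text \<open>The vector \<open>F\<^bsub>t,s\<^esub>\<close>.\<close>

fun slice :: "(complex \<times> complex \<Rightarrow> complex) \<Rightarrow> real \<times> real \<Rightarrow> bdry_fun" where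
  "slice F (t, s) E1 (x, \<theta>) = F (Complex x (s + t), complex_of_real (exp (s / 2)) * cis (2 * pi * \<theta>))"
| "slice F (t, s) E2 (x, \<theta>) = F (Complex x (s - t), complex_of_real (exp (s / 2)) * cis (2 * pi * \<theta>))"
| "slice F (t, s) E3 (x, \<theta>) = F (Complex x (- (s + t)), complex_of_real (exp (- s / 2)) * cis (2 * pi * \<theta>))"
| "slice F (t, s) E4 (x, \<theta>) = F (Complex x (- (s - t)), complex_of_real (exp (- s / 2)) * cis (2 * pi * \<theta>))"

definition slice_params :: "real \<Rightarrow> (real \<times> real) set" where
  "slice_params \<beta> = {0..<pi / 2} \<times> {0..<\<beta> - pi / 2}"

definition H2_worm_sq :: "real \<Rightarrow> (complex \<times> complex \<Rightarrow> complex) \<Rightarrow> ennreal" where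
  "H2_worm_sq \<beta> F = (SUP p\<in>slice_params \<beta>. bdry_sq (slice F p))"

definition H2_worm :: "real \<Rightarrow> (complex \<times> complex \<Rightarrow> complex) set" where
  "H2_worm \<beta> = {F. holomorphic2_on F (worm \<beta>) \<and> H2_worm_sq \<beta> F < \<infinity>}"

definition H2_worm_norm :: "real \<Rightarrow> (complex \<times> complex \<Rightarrow> complex) \<Rightarrow> real" where
  "H2_worm_norm \<beta> F = sqrt (enn2real (H2_worm_sq \<beta> F))"

definition strip :: "real \<Rightarrow> complex set" where
  "strip \<beta> = {z. \<bar>Im z\<bar> < \<beta>}"

definition H2_strip :: "real \<Rightarrow> (complex \<Rightarrow> complex) set" where
  "H2_strip \<beta> = {f. f holomorphic_on strip \<beta> \<and>
     (SUP y\<in>{0..<\<beta>}. L2_sq lborel (\<lambda>x. f (Complex x y)) + L2_sq lborel (\<lambda>x. f (Complex x (- y)))) < \<infinity>}"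

definition upper_trace :: "real \<Rightarrow> (complex \<Rightarrow> complex) \<Rightarrow> real \<Rightarrow> complex" where
  "upper_trace \<beta> f = (SOME g. L2_tendsto lborel (\<lambda>y x. f (Complex x y)) g (at_left \<beta>))"

definition lower_trace :: "real \<Rightarrow> (complex \<Rightarrow> complex) \<Rightarrow> real \<Rightarrow> complex" where
  "lower_trace \<beta> f = (SOME g. L2_tendsto lborel (\<lambda>y x. f (Complex x y)) g (at_right (- \<beta>)))"

text \<open>The extension of \<open>f\<close> to the closed strip; the traces, being elements of
  \<open>L\<^sup>2\<close>, are determined only almost everywhere.\<close>

definition strip_ext :: "real \<Rightarrow> (complex \<Rightarrow> complex) \<Rightarrow> complex \<Rightarrow> complex" where
  "strip_ext \<beta> f \<zeta> =
     (if Im \<zeta> = \<beta> then upper_trace \<beta> f (Re \<zeta>)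
      else if Im \<zeta> = - \<beta> then lower_trace \<beta> f (Re \<zeta>)
      else f \<zeta>)"

definition bdry_partial_sum :: "real \<Rightarrow> (int \<Rightarrow> complex \<Rightarrow> complex) \<Rightarrow> int set \<Rightarrow> bdry_fun" where
  "bdry_partial_sum \<beta> f J l p =
     (case bdry_point \<beta> l p of (\<zeta>1, \<zeta>2) \<Rightarrow> \<Sum>j\<in>J. strip_ext \<beta> (f j) \<zeta>1 * \<zeta>2 powi j)"

definition bdry_series_converges ::
  "real \<Rightarrow> (int \<Rightarrow> complex \<Rightarrow> complex) \<Rightarrow> bdry_fun \<Rightarrow> bool" where
  "bdry_series_converges \<beta> f G \<longleftrightarrow>
     bdry_tendsto (bdry_partial_sum \<beta> f) G (finite_subsets_at_top UNIV)"

definition bdry_ext :: "real \<Rightarrow> (int \<Rightarrow> complex \<Rightarrow> complex) \<Rightarrow> bdry_fun" where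
  "bdry_ext \<beta> f = (SOME G. bdry_series_converges \<beta> f G)"

end

theory Submission
  imports Defs
begin

text \<open>
  Write \<open>N\<^sub>j(y) = \<integral> \<bar>f\<^sub>j(x + iy)\<bar>\<^sup>2 dx\<close>.  By Parseval in \<open>\<theta>\<close>, the squared norm of the
  slice \<open>F\<^bsub>t,s\<^esub>\<close> is the sum over \<open>j\<close> of
  \<open>e\<^bsup>js\<^esup> (N\<^sub>j(s + t) + N\<^sub>j(s - t)) + e\<^bsup>-js\<^esup> (N\<^sub>j(-s + t) + N\<^sub>j(-s - t))\<close>,
  so the theorem is a statement about these four terms for each \<open>j\<close>.

  The main fact concerns one function \<open>f\<close> in the Hardy space of the strip, with lines
  \<open>f\<^sub>y(x) = f(x + iy)\<close> and energy \<open>N(y) = \<parallel>f\<^sub>y\<parallel>\<^sup>2\<close>.  The inner product of \<open>f\<^sub>y\<close> and \<open>f\<^sub>y\<^sub>'\<close> is,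
  with \<open>c = (y + y') / 2\<close>, the integral of the holomorphic function \<open>f(z + ic) \<cdot> cnj (f(cnj z + ic))\<close>
  over a horizontal line; moving that line to the real axis shows that it equals \<open>N(c)\<close>.
  This gives the midpoint identity
  \<open>\<parallel>f\<^sub>y - f\<^sub>y\<^sub>'\<parallel>\<^sup>2 = N(y) + N(y') - 2 N((y + y') / 2)\<close> (\<open>strip_midpoint_identity\<close>), with two
  consequences.

  \<^item> \<open>N\<close> is midpoint convex and bounded, therefore convex, therefore convergent at both ends of
    its interval.  By the identity the lines are then Cauchy at the ends, which yields the traces
    (\<open>upper_trace\<close>, \<open>lower_trace\<close>), and they depend continuously on the height inside.

  \<^item> The \<open>j\<close>-th term above increases with \<open>t\<close>, by convexity of \<open>N\<^sub>j\<close>.  It also increases with \<open>s\<close>,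
    by convexity of \<open>y \<mapsto> e\<^bsup>jy\<^esup> N\<^sub>j(y)\<close>, which is the energy of another Hardy function, namely
    \<open>e\<^bsup>-ijz/2\<^esup> f\<^sub>j(z)\<close> (\<open>total_energy_mono\<close>).

  Consequently every mode of a slice has at most the energy of the corresponding mode of the
  boundary function, and tends to it as \<open>(t, s)\<close> tends to the corner.  Finite sums of boundary
  energies are limits of quantities bounded by \<open>\<parallel>F\<parallel>\<^sup>2\<close>, so the boundary energies are summable; they
  dominate all slices, and dominated convergence over the modes
  (\<open>fourier_series_dominated_convergence\<close>) gives both the convergence of the slices and the
  equality of norms.
\<close>

section \<open>Square-integrable functions\<close>

lemma L2_measurable: "u \<in> L2 M \<Longrightarrow> u \<in> borel_measurable M"
  by (simp add: L2_def)

lemma L2_sq_finite: "u \<in> L2 M \<Longrightarrow> L2_sq M u < \<infinity>"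
  by (simp add: L2_def)

lemma L2_sq_diff_commute: "L2_sq M (\<lambda>x. u x - v x) = L2_sq M (\<lambda>x. v x - u x)"
  by (simp add: L2_sq_def norm_minus_commute)

lemma L2_sq_cmult:
  assumes "u \<in> borel_measurable M"
  shows "L2_sq M (\<lambda>x. c * u x) = ennreal ((cmod c)\<^sup>2) * L2_sq M u"
  using assms unfolding L2_sq_def
  by (simp add: norm_mult power_mult_distrib ennreal_mult nn_integral_cmult)

lemma norm_add_sq_le: "(norm (a + b))\<^sup>2 \<le> 2 * (norm a)\<^sup>2 + 2 * (norm b)\<^sup>2"
  for a b :: "'a::real_normed_vector"
proof -
  have "(norm (a + b))\<^sup>2 \<le> (norm a + norm b)\<^sup>2"
    by (simp add: norm_triangle_ineq power_mono)
  also have "\<dots> \<le> 2 * (norm a)\<^sup>2 + 2 * (norm b)\<^sup>2"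
    using zero_le_power2[of "norm a - norm b"] by (simp add: power2_eq_square algebra_simps)
  finally show ?thesis .
qed

lemma L2_sq_add_le:
  assumes "u \<in> borel_measurable M" "v \<in> borel_measurable M"
  shows "L2_sq M (\<lambda>x. u x + v x) \<le> 2 * L2_sq M u + 2 * L2_sq M v"
proof -
  have "L2_sq M (\<lambda>x. u x + v x)
      \<le> (\<integral>\<^sup>+x. 2 * ennreal ((cmod (u x))\<^sup>2) + 2 * ennreal ((cmod (v x))\<^sup>2) \<partial>M)"
    unfolding L2_sq_def
  proof (rule nn_integral_mono)
    fix x
    have "2 * ennreal ((cmod (u x))\<^sup>2) + 2 * ennreal ((cmod (v x))\<^sup>2)
        = ennreal (2 * (cmod (u x))\<^sup>2 + 2 * (cmod (v x))\<^sup>2)"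
      by (simp add: ennreal_mult)
    then show "ennreal ((cmod (u x + v x))\<^sup>2)
        \<le> 2 * ennreal ((cmod (u x))\<^sup>2) + 2 * ennreal ((cmod (v x))\<^sup>2)"
      by (simp add: norm_add_sq_le ennreal_leI del: ennreal_plus)
  qed
  also have "\<dots> = 2 * L2_sq M u + 2 * L2_sq M v"
    using assms by (simp add: L2_sq_def nn_integral_add nn_integral_cmult)
  finally show ?thesis .
qed

lemma L2_sq_triangle:
  assumes "u \<in> borel_measurable M" "v \<in> borel_measurable M" "w \<in> borel_measurable M"
  shows "L2_sq M (\<lambda>x. u x - w x)
    \<le> 2 * L2_sq M (\<lambda>x. u x - v x) + 2 * L2_sq M (\<lambda>x. v x - w x)"
  using L2_sq_add_le[of "\<lambda>x. u x - v x" M "\<lambda>x. v x - w x"] assms by simp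

lemma L2_cmult: "u \<in> L2 M \<Longrightarrow> (\<lambda>x. c * u x) \<in> L2 M"
  by (auto simp: L2_def L2_sq_cmult ennreal_mult_less_top)

lemma L2_add:
  assumes "u \<in> L2 M" "v \<in> L2 M"
  shows "(\<lambda>x. u x + v x) \<in> L2 M"
proof -
  have "L2_sq M (\<lambda>x. u x + v x) \<le> 2 * L2_sq M u + 2 * L2_sq M v"
    using assms by (intro L2_sq_add_le L2_measurable)
  also have "\<dots> < \<infinity>"
    using assms by (simp add: L2_def ennreal_mult_less_top)
  finally show ?thesis
    using assms by (auto simp: L2_def)
qed

lemma L2_diff: "u \<in> L2 M \<Longrightarrow> v \<in> L2 M \<Longrightarrow> (\<lambda>x. u x - v x) \<in> L2 M"
  using L2_add[of u M "\<lambda>x. -1 * v x"] L2_cmult[of v M "-1"] by simp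

lemma L2_integrable: "u \<in> L2 M \<longleftrightarrow> u \<in> borel_measurable M \<and> integrable M (\<lambda>x. (cmod (u x))\<^sup>2)"
  by (auto simp: L2_def L2_sq_def integrable_iff_bounded)

lemma L2_sq_eq_integral: "u \<in> L2 M \<Longrightarrow> L2_sq M u = ennreal (\<integral>x. (cmod (u x))\<^sup>2 \<partial>M)"
  unfolding L2_integrable L2_sq_def by (subst nn_integral_eq_integral) auto

text \<open>The difference of the squared norms is controlled by
  \<open>2 \<bar>a\<bar> \<bar>b - a\<bar> \<le> \<delta> \<bar>a\<bar>\<^sup>2 + \<bar>b - a\<bar>\<^sup>2 / \<delta>\<close>, which replaces Minkowski's inequality.\<close>

lemma norm_sq_diff_le:
  fixes a b :: complex
  assumes "\<delta> > 0"
  shows "\<bar>(cmod b)\<^sup>2 - (cmod a)\<^sup>2\<bar> \<le> (1 + 1 / \<delta>) * (cmod (b - a))\<^sup>2 + \<delta> * (cmod a)\<^sup>2"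
proof -
  have 1: "(cmod b)\<^sup>2 \<le> (cmod a + cmod (b - a))\<^sup>2"
    using norm_triangle_sub[of b a] by (simp add: power_mono)
  have 2: "(cmod a)\<^sup>2 - 2 * cmod a * cmod (b - a) \<le> (cmod b)\<^sup>2"
  proof -
    have "cmod a \<le> cmod b + cmod (b - a)"
      using norm_triangle_sub[of a b] by (simp add: norm_minus_commute)
    then have "\<bar>cmod a\<bar> * (cmod a - cmod (b - a)) \<le> cmod a * cmod b"
      by (simp add: mult_left_mono)
    moreover have "2 * (cmod a * cmod b) \<le> (cmod a)\<^sup>2 + (cmod b)\<^sup>2"
      using zero_le_power2[of "cmod a - cmod b"] by (simp add: power2_eq_square algebra_simps)
    ultimately show ?thesis by (simp add: power2_eq_square algebra_simps)
  qed
  have "0 \<le> (sqrt \<delta> * cmod a - cmod (b - a) / sqrt \<delta>)\<^sup>2" by simp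
  also have "\<dots> = \<delta> * (cmod a)\<^sup>2 + (cmod (b - a))\<^sup>2 / \<delta> - 2 * cmod a * cmod (b - a)"
    using assms by (simp add: power2_diff power_mult_distrib power_divide)
  finally have "2 * cmod a * cmod (b - a) \<le> \<delta> * (cmod a)\<^sup>2 + (cmod (b - a))\<^sup>2 / \<delta>" by simp
  then show ?thesis
    using 1 2 zero_le_power2[of "cmod (b - a)"]
    unfolding power2_sum distrib_right abs_le_iff times_divide_eq_left mult_1_left by linarith
qed

lemma L2_tendsto_L2_sq:
  assumes "L2_tendsto M u g A"
  shows "((\<lambda>i. L2_sq M (u i)) \<longlongrightarrow> L2_sq M g) A"
proof -
  have g: "g \<in> L2 M" and u: "\<forall>\<^sub>F i in A. u i \<in> L2 M"
    and lim: "((\<lambda>i. L2_sq M (\<lambda>x. u i x - g x)) \<longlongrightarrow> 0) A"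
    using assms by (auto simp: L2_tendsto_def)
  define N where "N v = (\<integral>x. (cmod (v x))\<^sup>2 \<partial>M)" for v
  have N: "L2_sq M v = ennreal (N v)" "N v \<ge> 0" if "v \<in> L2 M" for v
    using that by (auto simp: N_def L2_sq_eq_integral)
  have dlim: "((\<lambda>i. N (\<lambda>x. u i x - g x)) \<longlongrightarrow> 0) A"
  proof -
    have "\<forall>\<^sub>F i in A. L2_sq M (\<lambda>x. u i x - g x) = ennreal (N (\<lambda>x. u i x - g x))"
      using u by eventually_elim (simp add: N g L2_diff)
    from tendsto_cong[OF this] have "((\<lambda>i. ennreal (N (\<lambda>x. u i x - g x))) \<longlongrightarrow> ennreal 0) A"
      using lim by simp
    moreover have "\<forall>\<^sub>F i in A. 0 \<le> N (\<lambda>x. u i x - g x)"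
      using u by eventually_elim (simp add: N g L2_diff)
    ultimately show ?thesis by (subst (asm) tendsto_ennreal_iff) auto
  qed
  have "((\<lambda>i. N (u i)) \<longlongrightarrow> N g) A"
  proof (rule tendstoI)
    fix e :: real assume e: "e > 0"
    \<comment> \<open>The summand \<open>1\<close> keeps the denominator positive when \<open>g = 0\<close>.\<close>
    define \<delta> where "\<delta> = e / (2 * (N g + 1))"
    have Ng: "N g \<ge> 0" using N g by blast
    have \<delta>: "\<delta> > 0" "\<delta> * N g < e / 2" 
      using e Ng by (auto simp: \<delta>_def field_simps)
    have "\<forall>\<^sub>F i in A. N (\<lambda>x. u i x - g x) < e / (2 * (1 + 1 / \<delta>))"
      using dlim e \<delta> by (intro order_tendstoD) (auto intro!: divide_pos_pos add_pos_pos)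
    with u show "\<forall>\<^sub>F i in A. dist (N (u i)) (N g) < e"
    proof eventually_elim
      case (elim i)
      have int: "integrable M (\<lambda>x. (cmod (u i x))\<^sup>2)" "integrable M (\<lambda>x. (cmod (g x))\<^sup>2)"
        "integrable M (\<lambda>x. (cmod (u i x - g x))\<^sup>2)"
        using elim g L2_diff[of "u i" M g] by (auto simp: L2_integrable)
      have "\<bar>N (u i) - N g\<bar> = \<bar>\<integral>x. (cmod (u i x))\<^sup>2 - (cmod (g x))\<^sup>2 \<partial>M\<bar>"
        using int by (simp add: N_def)
      also have "\<dots> \<le> (\<integral>x. \<bar>(cmod (u i x))\<^sup>2 - (cmod (g x))\<^sup>2\<bar> \<partial>M)"
        by (rule integral_abs_bound)
      also have "\<dots> \<le> (\<integral>x. (1 + 1 / \<delta>) * (cmod (u i x - g x))\<^sup>2 + \<delta> * (cmod (g x))\<^sup>2 \<partial>M)"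
        using int \<delta> by (intro integral_mono norm_sq_diff_le) auto
      also have "\<dots> = (1 + 1 / \<delta>) * N (\<lambda>x. u i x - g x) + \<delta> * N g"
        using int by (simp add: N_def)
      also have "\<dots> < e / 2 + e / 2"
      proof (rule add_strict_mono)
        have "1 + 1 / \<delta> > 0" using \<delta> by (simp add: add_pos_pos)
        then show "(1 + 1 / \<delta>) * N (\<lambda>x. u i x - g x) < e / 2"
          using elim(2) by (simp add: pos_less_divide_eq algebra_simps)
      qed (use \<delta> in auto)
      finally show ?case by (simp add: dist_real_def)
    qed
  qed
  then have "((\<lambda>i. ennreal (N (u i))) \<longlongrightarrow> ennreal (N g)) A"
    by (rule tendsto_ennrealI)
  moreover have "\<forall>\<^sub>F i in A. ennreal (N (u i)) = L2_sq M (u i)"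
    using u by eventually_elim (simp add: N)
  ultimately show ?thesis
    unfolding N(1)[OF g] by (rule Lim_transform_eventually)
qed

text \<open>Riesz--Fischer for nets.  Along a sequence with \<open>\<parallel>v\<^sub>n\<^sub>+\<^sub>1 - v\<^sub>n\<parallel>\<^sup>2 \<le> 16\<^sup>-\<^sup>n\<close> the
  function \<open>\<Sum>n. 4\<^sup>n \<bar>v\<^sub>n\<^sub>+\<^sub>1 - v\<^sub>n\<bar>\<^sup>2\<close> is integrable, so almost everywhere the increments
  are \<open>O(2\<^sup>-\<^sup>n)\<close> and the sequence converges; Fatou's lemma identifies the pointwise limit as
  the \<open>L\<^sup>2\<close> limit of the whole net.\<close>

lemma L2_complete:
  assumes A: "A \<noteq> bot" and u: "\<forall>\<^sub>F i in A. u i \<in> L2 M"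
    and cauchy: "\<And>e::real. e > 0 \<Longrightarrow>
      \<exists>P. eventually P A \<and> (\<forall>i j. P i \<longrightarrow> P j \<longrightarrow> L2_sq M (\<lambda>x. u i x - u j x) \<le> ennreal e)"
  shows "\<exists>g. L2_tendsto M u g A"
proof -
  \<comment> \<open>\<open>16\<^sup>-\<^sup>n\<close> leaves room for the weight \<open>4\<^sup>n\<close> below and still gives a convergent series.\<close>
  have "\<forall>n. \<exists>P. eventually P A \<and>
      (\<forall>i j. P i \<longrightarrow> P j \<longrightarrow> L2_sq M (\<lambda>x. u i x - u j x) \<le> ennreal ((1 / 16) ^ n))"
    by (intro allI cauchy) auto
  then obtain P0 where P0: "\<And>n. eventually (P0 n) A"
    "\<And>n i j. P0 n i \<Longrightarrow> P0 n j \<Longrightarrow> L2_sq M (\<lambda>x. u i x - u j x) \<le> ennreal ((1 / 16) ^ n)"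
    by metis
  define P where "P n i \<longleftrightarrow> P0 n i \<and> u i \<in> L2 M" for n i
  have Pev: "eventually (P n) A" for n
    unfolding P_def using P0(1) u by (rule eventually_conj)
  have P: "L2_sq M (\<lambda>x. u i x - u j x) \<le> ennreal ((1 / 16) ^ n)" if "P n i" "P n j" for n i j
    using P0(2) that unfolding P_def by blast
  have PL: "u i \<in> L2 M" if "P n i" for n i using that unfolding P_def by blast
  have "\<exists>i. \<forall>k\<in>{..n}. P k i" for n
    by (rule eventually_happens'[OF A]) (simp add: eventually_ball_finite Pev)
  then obtain i where i: "\<And>n k. k \<le> n \<Longrightarrow> P k (i n)" by (metis atMost_iff)
  define v where "v n = u (i n)" for n
  have v_L2: "v n \<in> L2 M" for n unfolding v_def by (rule PL) (rule i[OF order_refl])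
  have [measurable]: "v n \<in> borel_measurable M" for n by (rule L2_measurable) (rule v_L2)
  define S where "S x = (\<Sum>n. ennreal (4 ^ n * (cmod (v (Suc n) x - v n x))\<^sup>2))" for x
  have [measurable]: "S \<in> borel_measurable M" unfolding S_def by measurable
  have "(\<integral>\<^sup>+x. S x \<partial>M) = (\<Sum>n. ennreal (4 ^ n) * L2_sq M (\<lambda>x. v (Suc n) x - v n x))"
    unfolding S_def
    by (subst nn_integral_suminf) (auto simp: L2_sq_def ennreal_mult nn_integral_cmult)
  also have "\<dots> \<le> (\<Sum>n. ennreal ((1 / 4) ^ n))"
  proof (rule suminf_le)
    fix n
    have "L2_sq M (\<lambda>x. v (Suc n) x - v n x) \<le> ennreal ((1 / 16) ^ n)"
      unfolding v_def by (rule P) (auto intro: i)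
    then have "ennreal (4 ^ n) * L2_sq M (\<lambda>x. v (Suc n) x - v n x)
        \<le> ennreal (4 ^ n) * ennreal ((1 / 16) ^ n)"
      by (rule mult_left_mono) simp
    also have "\<dots> = ennreal ((4 * (1 / 16)) ^ n)"
      by (simp only: power_mult_distrib ennreal_mult zero_le_power zero_le_numeral 
        zero_le_divide_1_iff)
    finally show "ennreal (4 ^ n) * L2_sq M (\<lambda>x. v (Suc n) x - v n x) \<le> ennreal ((1 / 4) ^ n)"
      by simp
  qed auto
  also have "\<dots> < \<infinity>"
    by (subst suminf_ennreal2) (auto intro: summable_geometric)
  finally have "AE x in M. S x \<noteq> \<infinity>"
    by (intro nn_integral_PInf_AE) auto
  then have conv: "AE x in M. (\<lambda>n. v n x) \<longlonglongrightarrow> lim (\<lambda>n. v n x)"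
  proof eventually_elim
    case (elim x)
    then obtain C where C: "C \<ge> 0" "S x = ennreal C" by (cases "S x") auto
    have increment: "cmod (v (Suc n) x - v n x) \<le> sqrt C * (1 / 2) ^ n" for n
    proof -
      have "ennreal (4 ^ n * (cmod (v (Suc n) x - v n x))\<^sup>2) \<le> S x"
        unfolding S_def
        by (rule order_trans[OF _ sum_le_suminf[of _ "{n}"]]) auto
      moreover have "(2 ^ n)\<^sup>2 = (4::real) ^ n"
        by (simp add: power2_eq_square flip: power_mult_distrib)
      ultimately have "(2 ^ n * cmod (v (Suc n) x - v n x))\<^sup>2 \<le> C"
        using C by (simp add: power_mult_distrib)
      then have "2 ^ n * cmod (v (Suc n) x - v n x) \<le> sqrt C"
        by (rule real_le_rsqrt)
      then show ?thesis by (simp add: power_one_over pos_le_divide_eq mult.commute)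
    qed
    have "summable (\<lambda>n. sqrt C * (1 / 2) ^ n)"
      by (rule summable_mult, rule summable_geometric) simp
    then have "summable (\<lambda>n. v (Suc n) x - v n x)"
      by (rule summable_comparison_test'[where N = 0]) (rule increment)
    then have "convergent (\<lambda>n. v n x - v 0 x)"
      unfolding summable_iff_convergent sum_lessThan_telescope[of "\<lambda>n. v n x"] .
    from convergent_add[OF this convergent_const[of "v 0 x"]] have "convergent (\<lambda>n. v n x)"
      by simp
    then show ?case by (rule convergent_LIMSEQ_iff[THEN iffD1])
  qed
  define g where "g x = lim (\<lambda>n. v n x)" for x
  have [measurable]: "g \<in> borel_measurable M" unfolding g_def by measurable
  have bound: "L2_sq M (\<lambda>x. u j x - g x) \<le> ennreal ((1 / 16) ^ k)" if j: "P k j" for k j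
  proof -
    have [measurable]: "u j \<in> borel_measurable M" using PL[OF j] by (rule L2_measurable)
    have "L2_sq M (\<lambda>x. u j x - g x)
        = (\<integral>\<^sup>+x. liminf (\<lambda>n. ennreal ((cmod (u j x - v n x))\<^sup>2)) \<partial>M)"
      unfolding L2_sq_def
    proof (rule nn_integral_cong_AE, use conv in eventually_elim)
      case (elim x)
      then have "(\<lambda>n. ennreal ((cmod (u j x - v n x))\<^sup>2)) \<longlonglongrightarrow> ennreal ((cmod (u j x - g x))\<^sup>2)"
        unfolding g_def by (intro tendsto_intros)
      then show ?case
        by (intro lim_imp_Liminf[symmetric]) auto
    qed
    also have "\<dots> \<le> liminf (\<lambda>n. L2_sq M (\<lambda>x. u j x - v n x))"
      unfolding L2_sq_def by (rule nn_integral_liminf) measurable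
    also have "\<dots> \<le> ennreal ((1 / 16) ^ k)"
    proof (rule Liminf_le)
      show "\<forall>\<^sub>F n in sequentially. L2_sq M (\<lambda>x. u j x - v n x) \<le> ennreal ((1 / 16) ^ k)"
        using eventually_ge_at_top[of k] by eventually_elim (auto simp: v_def intro!: P j i)
    qed simp
    finally show ?thesis .
  qed
  have g_L2: "g \<in> L2 M"
  proof -
    have "(\<lambda>x. v 0 x - g x) \<in> L2 M"
      using bound[of 0 "i 0"] i[of 0 0] by (auto simp: L2_def v_def[symmetric]
        intro: le_less_trans)
    from L2_diff[OF v_L2[of 0] this] show ?thesis by simp
  qed
  have "((\<lambda>j. L2_sq M (\<lambda>x. u j x - g x)) \<longlongrightarrow> 0) A"
  proof (rule order_tendstoI)
    fix e :: ennreal assume "0 < e"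
    moreover have "(\<lambda>k. ennreal ((1 / 16) ^ k)) \<longlonglongrightarrow> ennreal 0"
      by (intro tendsto_ennrealI LIMSEQ_realpow_zero) auto
    ultimately have "\<forall>\<^sub>F k in sequentially. ennreal ((1 / 16) ^ k) < e"
      by (intro order_tendstoD) auto
    then obtain k where k: "ennreal ((1 / 16) ^ k) < e"
      by (auto simp: eventually_sequentially)
    show "\<forall>\<^sub>F j in A. L2_sq M (\<lambda>x. u j x - g x) < e"
      using Pev[of k] by eventually_elim (use bound k in \<open>blast intro: le_less_trans\<close>)
  qed auto
  with g_L2 u show ?thesis by (auto simp: L2_tendsto_def)
qed

section \<open>Moving a line of integration in a strip\<close>

lemma Complex_in_strip [simp]: "Complex x y \<in> strip r \<longleftrightarrow> \<bar>y\<bar> < r"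
  by (simp add: strip_def)

lemma strip_eq: "strip r = {z. Im z < r} \<inter> {z. Im z > - r}"
  by (auto simp: strip_def)

lemma open_strip: "open (strip r)"
  unfolding strip_eq by (intro open_Int open_halfspace_Im_lt open_halfspace_Im_gt)

lemma convex_strip: "convex (strip r)"
  unfolding strip_eq by (intro convex_Int convex_halfspace_Im_lt convex_halfspace_Im_gt)

lemma continuous_on_Complex [continuous_intros]:
  "continuous_on S a \<Longrightarrow> continuous_on S b \<Longrightarrow> continuous_on S (\<lambda>x. Complex (a x) (b x))"
  unfolding Complex_eq by (intro continuous_intros)

lemma has_vector_derivative_horizontal:
  assumes "(G has_field_derivative g) (at (Complex x y))"
  shows "((\<lambda>x. G (Complex x y)) has_vector_derivative g) (at x within S)"
proof -
  have "((\<lambda>x. Complex x y) has_vector_derivative 1) (at x within S)"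
    unfolding Complex_eq by (auto intro!: derivative_eq_intros simp: has_vector_derivative_def scaleR_conv_of_real fun_eq_iff mult.commute)
  from field_vector_diff_chain_within[OF this, of G g] assms show ?thesis
    by (simp add: o_def has_field_derivative_at_within)
qed

lemma has_vector_derivative_vertical:
  assumes "(G has_field_derivative g) (at (Complex x y))"
  shows "((\<lambda>y. G (Complex x y)) has_vector_derivative \<i> * g) (at y within S)"
proof -
  have "((\<lambda>y. Complex x y) has_vector_derivative \<i>) (at y within S)"
    unfolding Complex_eq by (auto intro!: derivative_eq_intros simp: has_vector_derivative_def scaleR_conv_of_real fun_eq_iff mult.commute)
  from field_vector_diff_chain_within[OF this, of G g] assms show ?thesis
    by (simp add: o_def has_field_derivative_at_within)
qed

lemma holomorphic_strip_measurable:
  assumes "h holomorphic_on strip r" "\<bar>y\<bar> < r"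
  shows "(\<lambda>x. h (Complex x y)) \<in> borel_measurable lborel"
proof -
  have "continuous_on UNIV (\<lambda>x. h (Complex x y))"
    using assms by (intro continuous_on_compose2[OF holomorphic_on_imp_continuous_on[OF assms(1)]]
      continuous_intros) auto
  then show ?thesis by (simp add: borel_measurable_continuous_onI)
qed

lemma emeasure_lborel_atLeast: "emeasure lborel {a::real..} = \<infinity>"
proof (rule ccontr)
  assume "emeasure lborel {a..} \<noteq> \<infinity>"
  then obtain m where m: "m \<ge> 0" "emeasure lborel {a..} = ennreal m"
    by (cases "emeasure lborel {a..}") auto
  have "emeasure lborel {a..a + (m + 1)} \<le> emeasure lborel {a..}"
    by (intro emeasure_mono) auto
  with m show False by simp
qed

text \<open>This removes the vertical sides in the contour shift: nothing is known about their pointwise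
  decay, but a convergent function below an integrable one has limit zero.\<close>

lemma tendsto_le_integrable_imp_zero:
  fixes D :: "real \<Rightarrow> complex"
  assumes D: "(D \<longlongrightarrow> L) at_top" and le: "\<forall>\<^sub>F R in at_top. ennreal (cmod (D R)) \<le> W R"
    and W: "(\<integral>\<^sup>+R. W R \<partial>lborel) < \<infinity>"
  shows "L = 0"
proof (rule ccontr)
  assume "L \<noteq> 0"
  then have c: "cmod L / 2 > 0" by simp
  have "\<forall>\<^sub>F R in at_top. cmod L / 2 < cmod (D R)"
    using tendsto_norm[OF D] c by (intro order_tendstoD) auto
  with le have "\<forall>\<^sub>F R in at_top. ennreal (cmod L / 2) \<le> W R"
    by eventually_elim (metis ennreal_leI less_imp_le order_trans)
  then obtain R0 where R0: "\<And>R. R \<ge> R0 \<Longrightarrow> ennreal (cmod L / 2) \<le> W R"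
    by (auto simp: eventually_at_top_linorder)
  have "(\<integral>\<^sup>+R. ennreal (cmod L / 2) * indicator {R0..} R \<partial>lborel) \<le> (\<integral>\<^sup>+R. W R \<partial>lborel)"
    using R0 by (intro nn_integral_mono) (auto split: split_indicator)
  moreover have "(\<integral>\<^sup>+R. ennreal (cmod L / 2) * indicator {R0..} R \<partial>lborel) = \<infinity>"
    using c by (subst nn_integral_cmult_indicator) (auto simp: ennreal_mult_top emeasure_lborel_atLeast)
  ultimately show False using W by simp
qed

text \<open>Cauchy's theorem for the rectangle \<open>[-R, R] \<times> [y\<^sub>1, y\<^sub>2]\<close>, expressed through a
  primitive \<open>G\<close>.  The two horizontal sides converge as \<open>R\<close> grows; the vertical sides are, as
  functions of \<open>R\<close>, dominated by an integrable function, so they can only converge to zero.\<close>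

lemma strip_integral_shift:
  assumes h: "h holomorphic_on strip r"
    and bound: "\<And>y. \<bar>y\<bar> < r \<Longrightarrow> (\<integral>\<^sup>+x. ennreal (cmod (h (Complex x y))) \<partial>lborel) \<le> ennreal K"
    and y: "\<bar>y1\<bar> < r" "\<bar>y2\<bar> < r" "y1 \<le> y2"
  shows "(\<integral>x. h (Complex x y1) \<partial>lborel) = (\<integral>x. h (Complex x y2) \<partial>lborel)"
proof -
  obtain G where G: "\<And>z. z \<in> strip r \<Longrightarrow> (G has_field_derivative h z) (at z)"
    using holomorphic_convex_primitive'[OF convex_strip open_strip h] 
    by (metis at_within_open open_strip)
  have cont: "continuous_on (strip r) h" using h by (rule holomorphic_on_imp_continuous_on)
  have int: "integrable lborel (\<lambda>x. h (Complex x y))" if "\<bar>y\<bar> < r" for y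
    using bound[OF that] holomorphic_strip_measurable[OF h that]
    by (intro integrableI_bounded) (auto intro: le_less_trans)
  define V where "V R = (\<integral>\<^sup>+y. ennreal (cmod (h (Complex R y))) * indicator {y1..y2} y \<partial>lborel)" for R
  define E where "E R = G (Complex R y2) - G (Complex R y1)" for R
  have E_le: "ennreal (cmod (E R)) \<le> V R" for R
  proof -
    have "has_bochner_integral lborel (\<lambda>y. indicator {y1..y2} y *\<^sub>R (\<i> * h (Complex R y))) (E R)"
      unfolding E_def using y
      by (intro has_bochner_integral_FTC_Icc has_vector_derivative_vertical G
        continuous_intros continuous_on_compose2[OF cont]) auto
    then have "ennreal (cmod (E R)) \<le> (\<integral>\<^sup>+y. cmod (indicator {y1..y2} y *\<^sub>R (\<i> * h (Complex R y))) \<partial>lborel)"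
      by (metis has_bochner_integral_iff integral_norm_bound_ennreal)
    also have "\<dots> = V R"
      unfolding V_def by (intro nn_integral_cong) (auto simp: norm_mult split: split_indicator)
    finally show ?thesis .
  qed
  have meas: "(\<lambda>p. ennreal (cmod (h (Complex (fst p) (snd p)))) * indicator {y1..y2} (snd p))
      \<in> borel_measurable (lborel \<Otimes>\<^sub>M lborel)"
  proof -
    have "continuous_on (UNIV \<times> {y1..y2}) (\<lambda>p. cmod (h (Complex (fst p) (snd p))))"
      using y by (intro continuous_intros continuous_on_compose2[OF cont]) auto
    then have "(\<lambda>p. indicator (UNIV \<times> {y1..y2}) p *\<^sub>R cmod (h (Complex (fst p) (snd p))))
        \<in> borel_measurable (borel :: (real \<times> real) measure)"
      by (intro borel_measurable_continuous_on_indicator) (auto intro!: borel_closed closed_Times)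
    then have "(\<lambda>p. ennreal (indicator (UNIV \<times> {y1..y2}) p *\<^sub>R cmod (h (Complex (fst p) (snd p)))))
        \<in> borel_measurable (lborel \<Otimes>\<^sub>M lborel)"
      by (simp add: lborel_prod)
    also have "(\<lambda>p. ennreal (indicator (UNIV \<times> {y1..y2}) p *\<^sub>R cmod (h (Complex (fst p) (snd p)))))
        = (\<lambda>p. ennreal (cmod (h (Complex (fst p) (snd p)))) * indicator {y1..y2} (snd p))"
      by (auto simp: fun_eq_iff split: split_indicator)
    finally show ?thesis .
  qed
  have V_int: "(\<integral>\<^sup>+R. V R \<partial>lborel) \<le> ennreal K * ennreal (y2 - y1)"
  proof -
    have "(\<integral>\<^sup>+R. V R \<partial>lborel)
        = (\<integral>\<^sup>+y. \<integral>\<^sup>+R. ennreal (cmod (h (Complex R y))) * indicator {y1..y2} y \<partial>lborel \<partial>lborel)"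
      unfolding V_def using lborel_pair.Fubini[OF meas] by simp
    also have "\<dots> \<le> (\<integral>\<^sup>+y. ennreal K * indicator {y1..y2} y \<partial>lborel)"
    proof (rule nn_integral_mono)
      fix y
      show "(\<integral>\<^sup>+R. ennreal (cmod (h (Complex R y))) * indicator {y1..y2} y \<partial>lborel)
          \<le> ennreal K * indicator {y1..y2} y"
        using bound[of y] y by (auto split: split_indicator)
    qed
    also have "\<dots> = ennreal K * ennreal (y2 - y1)"
      using y by (subst nn_integral_cmult_indicator) auto
    finally show ?thesis .
  qed
  have V_meas: "V \<in> borel_measurable lborel"
    unfolding V_def using lborel.borel_measurable_nn_integral_fst[OF meas] by simp
  have V_reflect: "(\<integral>\<^sup>+R. V (- R) \<partial>lborel) = (\<integral>\<^sup>+R. V R \<partial>lborel)"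
    using nn_integral_real_affine[of V "-1" 0] V_meas by simp
  define k where "k x = h (Complex x y2) - h (Complex x y1)" for x
  have k: "integrable lborel k" unfolding k_def using int y by (intro Bochner_Integration.integrable_diff)
  have "((\<lambda>R. \<integral>x. indicator {-R..R} x *\<^sub>R k x \<partial>lborel) \<longlongrightarrow> (\<integral>x. k x \<partial>lborel)) at_top"
  proof (rule integral_dominated_convergence_at_top)
    show "AE x in lborel. ((\<lambda>R. indicator {-R..R} x *\<^sub>R k x) \<longlongrightarrow> k x) at_top"
    proof (rule AE_I2)
      fix x :: real
      have "\<forall>\<^sub>F R in at_top. k x = indicator {-R..R} x *\<^sub>R k x"
        using eventually_ge_at_top[of "\<bar>x\<bar>"] by eventually_elim (simp add: indicator_def abs_le_iff minus_le_iff)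
      then show "((\<lambda>R. indicator {-R..R} x *\<^sub>R k x) \<longlongrightarrow> k x) at_top"
        by (rule Lim_transform_eventually[OF tendsto_const])
    qed
    show "\<forall>\<^sub>F R in at_top. AE x in lborel. norm (indicator {-R..R} x *\<^sub>R k x) \<le> cmod (k x)"
      by (auto split: split_indicator)
    show "integrable lborel (\<lambda>x. cmod (k x))" using k by (rule integrable_norm)
  qed (use k in \<open>auto intro: borel_measurable_integrable\<close>)
  moreover have "\<forall>\<^sub>F R in at_top. (\<integral>x. indicator {-R..R} x *\<^sub>R k x \<partial>lborel) = E R - E (- R)"
    using eventually_ge_at_top[of 0]
  proof eventually_elim
    case (elim R)
    have "(\<integral>x. indicator {-R..R} x *\<^sub>R k x \<partial>lborel)
        = (G (Complex R y2) - G (Complex R y1)) - (G (Complex (-R) y2) - G (Complex (-R) y1))"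
      unfolding k_def using y elim
      by (intro integral_FTC_Icc has_vector_derivative_diff has_vector_derivative_horizontal G
        continuous_intros continuous_on_compose2[OF cont]) auto
    then show ?case by (simp add: E_def)
  qed
  ultimately have lim: "((\<lambda>R. E R - E (- R)) \<longlongrightarrow> (\<integral>x. k x \<partial>lborel)) at_top"
    by (rule Lim_transform_eventually)
  have "(\<integral>x. k x \<partial>lborel) = 0"
  proof (rule tendsto_le_integrable_imp_zero[OF lim])
    show "\<forall>\<^sub>F R in at_top. ennreal (cmod (E R - E (- R))) \<le> V R + V (- R)"
    proof (rule always_eventually, rule allI)
      fix R
      have "ennreal (cmod (E R - E (- R))) \<le> ennreal (cmod (E R) + cmod (E (- R)))"
        by (intro ennreal_leI norm_triangle_ineq4)
      also have "\<dots> \<le> V R + V (- R)"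
        by (simp add: add_mono E_le)
      finally show "ennreal (cmod (E R - E (- R))) \<le> V R + V (- R)" .
    qed
    have "(\<lambda>R. V (- R)) \<in> borel_measurable lborel" using V_meas by simp
    then have "(\<integral>\<^sup>+R. V R + V (- R) \<partial>lborel) = (\<integral>\<^sup>+R. V R \<partial>lborel) + (\<integral>\<^sup>+R. V R \<partial>lborel)"
      using V_meas by (simp add: nn_integral_add V_reflect)
    moreover have "(\<integral>\<^sup>+R. V R \<partial>lborel) < \<infinity>"
      using V_int by (rule le_less_trans) (simp add: ennreal_mult_less_top)
    ultimately show "(\<integral>\<^sup>+R. V R + V (- R) \<partial>lborel) < \<infinity>" by simp
  qed
  then show ?thesis
    unfolding k_def using int y by simp
qed

section \<open>Convexity of the energy of a line\<close>

text \<open>Let \<open>d\<close> be the difference between \<open>\<phi>\<close> and its chord, reparametrised over \<open>[0, 1]\<close>.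
  Each \<open>t\<close> is the midpoint of an end point, where \<open>d\<close> vanishes, and another point, so that
  \<open>sup d \<le> (sup d) / 2\<close>.\<close>

lemma midpoint_convex_bounded_imp_convex:
  fixes \<phi> :: "real \<Rightarrow> real"
  assumes I: "convex I" and bdd: "\<And>x. x \<in> I \<Longrightarrow> \<phi> x \<le> K"
    and mid: "\<And>x y. x \<in> I \<Longrightarrow> y \<in> I \<Longrightarrow> 2 * \<phi> ((x + y) / 2) \<le> \<phi> x + \<phi> y"
  shows "convex_on I \<phi>"
proof (rule convex_onI)
  fix t x y assume t: "0 < t" "t < (1::real)" and xy: "x \<in> I" "y \<in> I"
  define p where "p t = (1 - t) * x + t * y" for t
  define d where "d t = \<phi> (p t) - ((1 - t) * \<phi> x + t * \<phi> y)" for t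
  have pI: "p t \<in> I" if "t \<in> {0..1}" for t
    using convexD_alt[OF I xy, of t] that by (simp add: p_def)
  have d_mid: "2 * d ((a + b) / 2) \<le> d a + d b" if "a \<in> {0..1}" "b \<in> {0..1}" for a b
  proof -
    have p_mid: "p ((a + b) / 2) = (p a + p b) / 2"
      by (simp add: p_def field_simps)
    have "2 * ((1 - (a + b) / 2) * \<phi> x + (a + b) / 2 * \<phi> y)
        = ((1 - a) * \<phi> x + a * \<phi> y) + ((1 - b) * \<phi> x + b * \<phi> y)"
      by (simp add: field_simps)
    moreover have "2 * (P - A) \<le> (P1 - C1) + (P2 - C2)"
      if "2 * A = C1 + C2" "2 * P \<le> P1 + P2" for A C1 C2 P P1 P2 :: real
      using that by simp
    ultimately show ?thesis
      using mid[OF pI[OF that(1)] pI[OF that(2)]] unfolding d_def p_mid by blast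
  qed
  have d_bdd: "bdd_above (d ` {0..1})"
  proof (rule bdd_aboveI2)
    fix t :: real assume t: "t \<in> {0..1}"
    have "(1 - t) * \<phi> x \<ge> - \<bar>\<phi> x\<bar>" "t * \<phi> y \<ge> - \<bar>\<phi> y\<bar>"
      using t mult_left_le_one_le[of "\<bar>\<phi> x\<bar>" "1 - t"] mult_left_le_one_le[of "\<bar>\<phi> y\<bar>" t]
        abs_ge_minus_self[of "(1 - t) * \<phi> x"] abs_ge_minus_self[of "t * \<phi> y"]
      by (auto simp: abs_mult)
    then show "d t \<le> K + \<bar>\<phi> x\<bar> + \<bar>\<phi> y\<bar>"
      using bdd[OF pI[OF t]] by (simp add: d_def)
  qed
  define S where "S = Sup (d ` {0..1})"
  have le_S: "d t \<le> S" if "t \<in> {0..1}" for t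
    unfolding S_def using that by (intro cSup_upper d_bdd) auto
  have d01: "d 0 = 0" "d 1 = 0" by (auto simp: d_def p_def)
  have "S \<le> S / 2"
    unfolding S_def
  proof (rule cSup_least)
    fix s assume "s \<in> d ` {0..1}"
    then obtain t where t: "t \<in> {0..1}" "s = d t" by auto
    show "s \<le> Sup (d ` {0..1}) / 2"
    proof (cases "t \<le> 1 / 2")
      case True
      then show ?thesis
        using t d_mid[of 0 "2 * t"] le_S[of "2 * t"] by (auto simp: d01 S_def)
    next
      case False
      then show ?thesis
        using t d_mid[of 1 "2 * t - 1"] le_S[of "2 * t - 1"] by (auto simp: d01 S_def)
    qed
  qed auto
  then have "d t \<le> 0" using le_S[of t] t by auto
  then show "\<phi> ((1 - t) *\<^sub>R x + t *\<^sub>R y) \<le> (1 - t) * \<phi> x + t * \<phi> y"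
    by (simp add: d_def p_def)
qed (rule I)

lemma convex_on_symmetric_sum_mono:
  fixes \<phi> :: "real \<Rightarrow> real"
  assumes \<phi>: "convex_on I \<phi>" and I: "c - t \<in> I" "c + t \<in> I" and u: "0 \<le> u" "u \<le> t"
  shows "\<phi> (c + u) + \<phi> (c - u) \<le> \<phi> (c + t) + \<phi> (c - t)"
proof (cases "t = 0")
  case False
  define q where "q = (t - u) / (2 * t)"
  have t: "t > 0" using False u by simp
  have q: "0 \<le> q" "q \<le> 1" using t u by (auto simp: q_def field_simps)
  \<comment> \<open>\<open>c + u\<close> and \<open>c - u\<close> divide the interval from \<open>c - t\<close> to \<open>c + t\<close> in mirror-image ratios.\<close>
  have eq: "(1 - q) * (c + t) + q * (c - t) = c + u" "(1 - q) * (c - t) + q * (c + t) = c - u"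
    using t by (simp_all add: q_def field_simps)
  have "\<phi> (c + u) \<le> (1 - q) * \<phi> (c + t) + q * \<phi> (c - t)"
    using convex_onD[OF \<phi> q I(2,1)] by (simp add: eq)
  moreover have "\<phi> (c - u) \<le> (1 - q) * \<phi> (c - t) + q * \<phi> (c + t)"
    using convex_onD[OF \<phi> q I] by (simp add: eq)
  ultimately show ?thesis by (simp add: algebra_simps)
qed (use u in simp)

text \<open>The slopes from an interior point are increasing and bounded above.\<close>

lemma convex_on_bounded_has_left_limit:
  fixes \<phi> :: "real \<Rightarrow> real"
  assumes \<beta>: "\<beta> > 0" and \<phi>: "convex_on {-\<beta><..<\<beta>} \<phi>"
    and bdd: "\<And>x. \<bar>x\<bar> < \<beta> \<Longrightarrow> \<phi> x \<le> K"
  shows "\<exists>L. (\<phi> \<longlongrightarrow> L) (at_left \<beta>)"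
proof -
  define q where "q x = (\<phi> x - \<phi> 0) / x" for x
  have mono: "q a \<le> q b" if "0 < a" "a \<le> b" "b < \<beta>" for a b
  proof -
    have "\<phi> a \<le> (1 - a / b) * \<phi> 0 + a / b * \<phi> b"
      using convex_onD[OF \<phi>, of "a / b" 0 b] that \<beta> by simp
    then have "\<phi> a - \<phi> 0 \<le> a / b * (\<phi> b - \<phi> 0)" by (simp add: algebra_simps)
    then show ?thesis using that by (simp add: q_def field_simps)
  qed
  have q_le: "q b \<le> \<bar>K - \<phi> 0\<bar> / (\<beta> / 2)" if "\<beta> / 2 < b" "b < \<beta>" for b
  proof -
    have "q b \<le> \<bar>K - \<phi> 0\<bar> / b"
      using bdd[of b] that \<beta> by (auto simp: q_def intro!: divide_right_mono)
    also have "\<dots> \<le> \<bar>K - \<phi> 0\<bar> / (\<beta> / 2)"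
      using that \<beta> by (intro divide_left_mono) auto
    finally show ?thesis .
  qed
  have "(q \<longlongrightarrow> Sup (q ` ({..<\<beta>} \<inter> {\<beta> / 2<..}))) (at \<beta> within ({..<\<beta>} \<inter> {\<beta> / 2<..}))"
  proof (rule Lim_left_bound)
    show "q a \<le> q b" if "a \<in> {\<beta> / 2<..}" "b \<in> {\<beta> / 2<..}" "b < \<beta>" "a \<le> b" for a b
      using that \<beta> by (intro mono) auto
    show "q b \<le> \<bar>K - \<phi> 0\<bar> / (\<beta> / 2)" if "b \<in> {\<beta> / 2<..}" "b < \<beta>" for b
      using that by (intro q_le) auto
  qed
  also have "at \<beta> within ({..<\<beta>} \<inter> {\<beta> / 2<..}) = at_left \<beta>"
    using \<beta> by (intro at_within_nhd[of _ "{\<beta> / 2<..}"]) auto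
  finally obtain l where "(q \<longlongrightarrow> l) (at_left \<beta>)" by blast
  then have "((\<lambda>x. x * q x + \<phi> 0) \<longlongrightarrow> \<beta> * l + \<phi> 0) (at_left \<beta>)"
    by (intro tendsto_intros)
  moreover have "\<forall>\<^sub>F x in at_left \<beta>. x * q x + \<phi> 0 = \<phi> x"
    using eventually_at_left_real[OF \<beta>] by eventually_elim (simp add: q_def)
  ultimately show ?thesis by (blast intro: Lim_transform_eventually)
qed

lemma convex_on_bounded_has_right_limit:
  fixes \<phi> :: "real \<Rightarrow> real"
  assumes \<beta>: "\<beta> > 0" and \<phi>: "convex_on {-\<beta><..<\<beta>} \<phi>"
    and bdd: "\<And>x. \<bar>x\<bar> < \<beta> \<Longrightarrow> \<phi> x \<le> K"
  shows "\<exists>L. (\<phi> \<longlongrightarrow> L) (at_right (- \<beta>))"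
proof -
  have "convex_on {-\<beta><..<\<beta>} (\<lambda>x. \<phi> (- x))"
  proof (rule convex_onI)
    fix t x y :: real
    assume t: "0 < t" "t < 1" and xy: "x \<in> {-\<beta><..<\<beta>}" "y \<in> {-\<beta><..<\<beta>}"
    have "- ((1 - t) *\<^sub>R x + t *\<^sub>R y) = (1 - t) *\<^sub>R (- x) + t *\<^sub>R (- y)"
      by simp
    then show "\<phi> (- ((1 - t) *\<^sub>R x + t *\<^sub>R y)) \<le> (1 - t) * \<phi> (- x) + t * \<phi> (- y)"
      using convex_onD[OF \<phi>, of t "- x" "- y"] t xy by simp
  qed simp
  then obtain L where "((\<lambda>x. \<phi> (- x)) \<longlongrightarrow> L) (at_left \<beta>)"
    using convex_on_bounded_has_left_limit[OF \<beta>, of "\<lambda>x. \<phi> (- x)" K] bdd by auto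
  then have "(\<phi> \<longlongrightarrow> L) (at_right (- \<beta>))"
    by (simp add: filterlim_at_left_to_right[of _ _ \<beta>])
  then show ?thesis ..
qed

definition line_energy :: "(complex \<Rightarrow> complex) \<Rightarrow> real \<Rightarrow> real" where
  "line_energy f y = (\<integral>x. (cmod (f (Complex x y)))\<^sup>2 \<partial>lborel)"

lemma H2_stripD:
  assumes f: "f \<in> H2_strip \<beta>"
  shows "f holomorphic_on strip \<beta>"
    and "\<exists>K\<ge>0. \<forall>y. \<bar>y\<bar> < \<beta> \<longrightarrow> L2_sq lborel (\<lambda>x. f (Complex x y)) \<le> ennreal K"
proof -
  show "f holomorphic_on strip \<beta>" using f by (simp add: H2_strip_def)
  define N where "N y = L2_sq lborel (\<lambda>x. f (Complex x y))" for y
  have "(SUP y\<in>{0..<\<beta>}. N y + N (- y)) < \<infinity>" using f by (simp add: H2_strip_def N_def)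
  then obtain K where K: "K \<ge> 0" "(SUP y\<in>{0..<\<beta>}. N y + N (- y)) = ennreal K"
    by (cases "SUP y\<in>{0..<\<beta>}. N y + N (- y)") auto
  have le: "N y + N (- y) \<le> ennreal K" if "y \<in> {0..<\<beta>}" for y
    unfolding K(2)[symmetric] using that by (rule SUP_upper)
  have "N y \<le> ennreal K" if "\<bar>y\<bar> < \<beta>" for y
  proof (cases "y \<ge> 0")
    case True
    have "N y \<le> N y + N (- y)" by simp
    also have "\<dots> \<le> ennreal K" using True that by (intro le) simp
    finally show ?thesis .
  next
    case False
    have "N y \<le> N (- y) + N (- (- y))" by simp
    also have "\<dots> \<le> ennreal K" using False that by (intro le) simp
    finally show ?thesis .
  qed
  with K show "\<exists>K\<ge>0. \<forall>y. \<bar>y\<bar> < \<beta> \<longrightarrow> L2_sq lborel (\<lambda>x. f (Complex x y)) \<le> ennreal K"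
    unfolding N_def by blast
qed

lemma H2_stripI:
  assumes "f holomorphic_on strip \<beta>"
    and "\<And>y. \<bar>y\<bar> < \<beta> \<Longrightarrow> L2_sq lborel (\<lambda>x. f (Complex x y)) \<le> ennreal K"
  shows "f \<in> H2_strip \<beta>"
proof -
  have "(SUP y\<in>{0..<\<beta>}. L2_sq lborel (\<lambda>x. f (Complex x y)) + L2_sq lborel (\<lambda>x. f (Complex x (- y))))
      \<le> ennreal K + ennreal K"
    by (rule SUP_least) (auto intro!: add_mono assms(2))
  also have "\<dots> < \<infinity>" by simp
  finally show ?thesis using assms(1) by (simp add: H2_strip_def)
qed

lemma H2_strip_line_L2:
  assumes "f \<in> H2_strip \<beta>" "\<bar>y\<bar> < \<beta>"
  shows "(\<lambda>x. f (Complex x y)) \<in> L2 lborel"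
  using H2_stripD[OF assms(1)] holomorphic_strip_measurable[of f \<beta> y] assms(2)
  by (auto simp: L2_def intro: le_less_trans)

lemma L2_sq_eq_line_energy:
  assumes "f \<in> H2_strip \<beta>" "\<bar>y\<bar> < \<beta>"
  shows "L2_sq lborel (\<lambda>x. f (Complex x y)) = ennreal (line_energy f y)"
  unfolding line_energy_def by (rule L2_sq_eq_integral) (rule H2_strip_line_L2[OF assms])

lemma line_energy_bounded:
  assumes "f \<in> H2_strip \<beta>"
  shows "\<exists>K\<ge>0. \<forall>y. \<bar>y\<bar> < \<beta> \<longrightarrow> line_energy f y \<le> K"
  using H2_stripD(2)[OF assms] by (metis L2_sq_eq_line_energy[OF assms] ennreal_le_iff)

lemma cmod_mult_le_half_squares: "cmod (a * cnj b) \<le> ((cmod a)\<^sup>2 + (cmod b)\<^sup>2) / 2"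
  using zero_le_power2[of "cmod a - cmod b"] by (simp add: norm_mult power2_eq_square algebra_simps)

lemma borel_measurable_cnj [measurable]: "cnj \<in> borel_measurable borel"
  by (intro borel_measurable_continuous_onI continuous_intros)

lemma L2_mult_cnj_integrable:
  assumes "u \<in> L2 M" "v \<in> L2 M"
  shows "integrable M (\<lambda>x. u x * cnj (v x))"
proof (rule Bochner_Integration.integrable_bound[where f = "\<lambda>x. ((cmod (u x))\<^sup>2 + (cmod (v x))\<^sup>2) / 2"])
  show "(\<lambda>x. u x * cnj (v x)) \<in> borel_measurable M"
  proof -
    have [measurable]: "u \<in> borel_measurable M" "v \<in> borel_measurable M"
      using assms by (auto intro: L2_measurable)
    show ?thesis by measurable
  qed
  have "integrable M (\<lambda>x. (cmod (u x))\<^sup>2)" "integrable M (\<lambda>x. (cmod (v x))\<^sup>2)"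
    using assms by (auto simp: L2_integrable)
  then show "integrable M (\<lambda>x. ((cmod (u x))\<^sup>2 + (cmod (v x))\<^sup>2) / 2)"
    by (intro integrable_divide Bochner_Integration.integrable_add)
  show "AE x in M. cmod (u x * cnj (v x)) \<le> norm (((cmod (u x))\<^sup>2 + (cmod (v x))\<^sup>2) / 2)"
    using cmod_mult_le_half_squares by auto
qed

text \<open>With \<open>c = (y + y') / 2\<close>, the function \<open>z \<mapsto> f (z + ic) \<cdot> cnj (f (cnj z + ic))\<close> is holomorphic.
  Its integral over the line at height \<open>(y - y') / 2\<close> is the inner product of the two lines of
  \<open>f\<close>, and its integral over the real line is the energy at height \<open>c\<close>.\<close>

lemma strip_inner_product:
  assumes f: "f \<in> H2_strip \<beta>" and y: "\<bar>y\<bar> < \<beta>" "\<bar>y'\<bar> < \<beta>" and le: "y' \<le> y"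
  shows "(\<integral>x. f (Complex x y) * cnj (f (Complex x y')) \<partial>lborel)
    = complex_of_real (line_energy f ((y + y') / 2))"
proof -
  define c u where "c = (y + y') / 2" and "u = (y - y') / 2"
  define r where "r = \<beta> - \<bar>c\<bar>"
  have cu: "c + u = y" "c - u = y'" by (auto simp: c_def u_def field_simps)
  have u: "\<bar>u\<bar> < r"
    using y by (auto simp: r_def c_def u_def abs_if field_simps)
  then have r: "\<bar>0\<bar> < r" by simp
  have u_nonneg: "0 \<le> u"
    using le unfolding u_def by simp
  have in_strip: "\<bar>c + v\<bar> < \<beta>" "\<bar>c - v\<bar> < \<beta>" if "\<bar>v\<bar> < r" for v
    using that unfolding r_def by (simp_all add: abs_le_iff)
  obtain K where K: "K \<ge> 0" "\<And>y. \<bar>y\<bar> < \<beta> \<Longrightarrow> line_energy f y \<le> K"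
    using line_energy_bounded[OF f] by blast
  define h where "h z = f (z + \<i> * c) * cnj (f (cnj z + \<i> * c))" for z
  have h_line: "h (Complex x v) = f (Complex x (c + v)) * cnj (f (Complex x (c - v)))" for x v
    unfolding h_def by (rule arg_cong2[where f = "\<lambda>a b. f a * cnj (f b)"]) (auto simp: complex_eq_iff)
  have "h holomorphic_on strip r"
  proof -
    have "(\<lambda>z. z + \<i> * c) holomorphic_on strip r"
      by (intro holomorphic_intros)
    moreover have "(\<lambda>z. z + \<i> * c) ` strip r \<subseteq> strip \<beta>"
      by (auto simp: strip_def r_def)
    ultimately have 1: "(\<lambda>z. f (z + \<i> * c)) holomorphic_on strip r"
      using holomorphic_on_compose_gen[OF _ H2_stripD(1)[OF f]] by (simp add: o_def)
    have "cnj ` strip r = strip r"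
      by (auto simp: strip_def image_iff) (metis complex_cnj_cnj cnj.simps(2) abs_minus_cancel)
    then have "cnj \<circ> (\<lambda>z. f (z + \<i> * c)) \<circ> cnj holomorphic_on strip r"
      using 1 by (intro holomorphic_on_compose_cnj_cnj open_strip) simp
    with 1 show ?thesis
      unfolding h_def by (auto simp: o_def intro!: holomorphic_intros)
  qed
  moreover have "(\<integral>\<^sup>+x. ennreal (cmod (h (Complex x v))) \<partial>lborel) \<le> ennreal K" if v: "\<bar>v\<bar> < r" for v
  proof -
    have [measurable]: "(\<lambda>x. f (Complex x (c + v))) \<in> borel_measurable lborel"
      "(\<lambda>x. f (Complex x (c - v))) \<in> borel_measurable lborel"
      by (rule holomorphic_strip_measurable[OF H2_stripD(1)[OF f]], rule in_strip[OF v])+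
    have "ennreal 2 * (\<integral>\<^sup>+x. ennreal (cmod (h (Complex x v))) \<partial>lborel)
        = (\<integral>\<^sup>+x. ennreal (2 * cmod (h (Complex x v))) \<partial>lborel)"
      by (subst nn_integral_cmult[symmetric]) (auto simp: h_line[abs_def] ennreal_mult)
    also have "\<dots> \<le> (\<integral>\<^sup>+x. ennreal ((cmod (f (Complex x (c + v))))\<^sup>2)
          + ennreal ((cmod (f (Complex x (c - v))))\<^sup>2) \<partial>lborel)"
    proof (rule nn_integral_mono)
      fix x
      have "2 * cmod (h (Complex x v))
          \<le> (cmod (f (Complex x (c + v))))\<^sup>2 + (cmod (f (Complex x (c - v))))\<^sup>2"
        using cmod_mult_le_half_squares[of "f (Complex x (c + v))" "f (Complex x (c - v))"]
        by (simp add: h_line)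
      then show "ennreal (2 * cmod (h (Complex x v))) \<le> ennreal ((cmod (f (Complex x (c + v))))\<^sup>2)
          + ennreal ((cmod (f (Complex x (c - v))))\<^sup>2)"
        by (simp add: ennreal_leI flip: ennreal_plus)
    qed
    also have "\<dots> = ennreal (line_energy f (c + v)) + ennreal (line_energy f (c - v))"
      using in_strip[OF v] by (simp add: nn_integral_add flip: L2_sq_eq_line_energy[OF f])
        (simp add: L2_sq_def)
    also have "\<dots> \<le> ennreal K + ennreal K"
      using in_strip[OF v] by (intro add_mono ennreal_leI K)
    also have "\<dots> = ennreal 2 * ennreal K"
      by (simp add: mult_2)
    finally show ?thesis
      by (subst (asm) ennreal_mult_le_mult_iff) auto
  qed
  ultimately have "(\<integral>x. h (Complex x 0) \<partial>lborel) = (\<integral>x. h (Complex x u) \<partial>lborel)"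
    by (rule strip_integral_shift) (use r u u_nonneg in simp_all)
  then have "(\<integral>x. f (Complex x y) * cnj (f (Complex x y')) \<partial>lborel)
      = (\<integral>x. complex_of_real ((cmod (f (Complex x c)))\<^sup>2) \<partial>lborel)"
    by (simp only: h_line cu complex_norm_square add_0_right diff_zero)
  then show ?thesis
    by (simp only: integral_complex_of_real line_energy_def c_def)
qed

text \<open>Expand the square; the cross term is the inner product just computed.\<close>

lemma strip_midpoint_identity:
  assumes f: "f \<in> H2_strip \<beta>" and y: "\<bar>y\<bar> < \<beta>" "\<bar>y'\<bar> < \<beta>"
  shows "L2_sq lborel (\<lambda>x. f (Complex x y) - f (Complex x y'))
    = ennreal (line_energy f y + line_energy f y' - 2 * line_energy f ((y + y') / 2))"
    and "2 * line_energy f ((y + y') / 2) \<le> line_energy f y + line_energy f y'"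
proof -
  have *: "L2_sq lborel (\<lambda>x. f (Complex x y) - f (Complex x y'))
      = ennreal (line_energy f y + line_energy f y' - 2 * line_energy f ((y + y') / 2))
      \<and> 2 * line_energy f ((y + y') / 2) \<le> line_energy f y + line_energy f y'"
    if y: "\<bar>y\<bar> < \<beta>" "\<bar>y'\<bar> < \<beta>" "y' \<le> y" for y y'
  proof -
    note L2y = H2_strip_line_L2[OF f y(1)] and L2y' = H2_strip_line_L2[OF f y(2)]
    let ?D = "\<integral>x. (cmod (f (Complex x y) - f (Complex x y')))\<^sup>2 \<partial>lborel"
    have prod: "integrable lborel (\<lambda>x. f (Complex x y) * cnj (f (Complex x y')))"
      by (rule L2_mult_cnj_integrable[OF L2y L2y'])
    have int: "integrable lborel (\<lambda>x. (cmod (f (Complex x y)))\<^sup>2)"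
      "integrable lborel (\<lambda>x. (cmod (f (Complex x y')))\<^sup>2)"
      using L2y L2y' by (auto simp: L2_integrable)
    have "?D = (\<integral>x. (cmod (f (Complex x y)))\<^sup>2 + (cmod (f (Complex x y')))\<^sup>2
        - 2 * Re (f (Complex x y) * cnj (f (Complex x y'))) \<partial>lborel)"
      by (intro Bochner_Integration.integral_cong refl)
        (simp only: cmod_power2 minus_complex.simps times_complex.simps cnj.simps,
          simp add: power2_eq_square algebra_simps)
    also have "\<dots> = line_energy f y + line_energy f y'
        - 2 * Re (\<integral>x. f (Complex x y) * cnj (f (Complex x y')) \<partial>lborel)"
      using int prod integrable_Re[OF prod] unfolding line_energy_def
      by (simp add: integral_Re del: times_complex.simps)
    also have "\<dots> = line_energy f y + line_energy f y' - 2 * line_energy f ((y + y') / 2)"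
      by (simp add: strip_inner_product[OF f y])
    finally have D: "?D = line_energy f y + line_energy f y' - 2 * line_energy f ((y + y') / 2)" .
    have "?D \<ge> 0" by simp
    with D show ?thesis
      using L2_sq_eq_integral[OF L2_diff[OF L2y L2y']] by simp
  qed
  show "L2_sq lborel (\<lambda>x. f (Complex x y) - f (Complex x y'))
      = ennreal (line_energy f y + line_energy f y' - 2 * line_energy f ((y + y') / 2))"
    and "2 * line_energy f ((y + y') / 2) \<le> line_energy f y + line_energy f y'"
    using *[of y y'] *[of y' y] y
    by (cases "y' \<le> y"; simp add: L2_sq_diff_commute[of _ "\<lambda>x. f (Complex x y)"] add.commute)+
qed

lemma line_energy_convex:
  assumes f: "f \<in> H2_strip \<beta>"
  shows "convex_on {-\<beta><..<\<beta>} (line_energy f)"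
proof -
  obtain K where "\<And>y. \<bar>y\<bar> < \<beta> \<Longrightarrow> line_energy f y \<le> K"
    using line_energy_bounded[OF f] by blast
  then show ?thesis
    by (intro midpoint_convex_bounded_imp_convex[where K = K] strip_midpoint_identity(2)[OF f]) auto
qed

section \<open>Boundary traces\<close>

text \<open>By the midpoint identity the lines of \<open>f\<close> form a Cauchy net wherever the energy has a limit.\<close>

lemma strip_lines_convergent:
  assumes f: "f \<in> H2_strip \<beta>" and nontrivial: "A \<noteq> bot"
    and inside: "\<forall>\<^sub>F y in A. \<bar>y\<bar> < \<beta>"
    and lim: "(line_energy f \<longlongrightarrow> L) A"
    and mid: "\<And>P. eventually P A \<Longrightarrow>
      \<exists>Q. eventually Q A \<and> (\<forall>y y'. Q y \<longrightarrow> Q y' \<longrightarrow> P ((y + y') / 2))"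
  shows "\<exists>g. L2_tendsto lborel (\<lambda>y x. f (Complex x y)) g A"
proof (rule L2_complete[OF nontrivial])
  show "\<forall>\<^sub>F y in A. (\<lambda>x. f (Complex x y)) \<in> L2 lborel"
    using inside by eventually_elim (rule H2_strip_line_L2[OF f])
  fix e :: real assume e: "e > 0"
  define P where "P y \<longleftrightarrow> \<bar>y\<bar> < \<beta> \<and> dist (line_energy f y) L < e / 4" for y
  have P: "eventually P A"
    unfolding P_def using inside tendstoD[OF lim, of "e / 4"] e by (auto intro: eventually_conj)
  obtain Q where Q: "eventually Q A" "\<And>y y'. Q y \<Longrightarrow> Q y' \<Longrightarrow> P ((y + y') / 2)"
    using mid[OF P] by blast
  have "L2_sq lborel (\<lambda>x. f (Complex x y) - f (Complex x y')) \<le> ennreal e"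
    if "P y \<and> Q y" "P y' \<and> Q y'" for y y'
  proof -
    have "P ((y + y') / 2)" using Q(2) that by blast
    then have "line_energy f y + line_energy f y' - 2 * line_energy f ((y + y') / 2) \<le> e"
      using that unfolding P_def dist_real_def by linarith
    then show ?thesis
      using that unfolding P_def by (simp add: strip_midpoint_identity(1)[OF f] ennreal_leI)
  qed
  moreover have "\<forall>\<^sub>F y in A. P y \<and> Q y" using P Q(1) by (rule eventually_conj)
  ultimately show "\<exists>P. eventually P A \<and> (\<forall>y y'. P y \<longrightarrow> P y' \<longrightarrow>
      L2_sq lborel (\<lambda>x. f (Complex x y) - f (Complex x y')) \<le> ennreal e)"
    by (intro exI[of _ "\<lambda>y. P y \<and> Q y"]) blast
qed

lemma upper_trace:
  assumes f: "f \<in> H2_strip \<beta>" and \<beta>: "\<beta> > 0"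
  shows "L2_tendsto lborel (\<lambda>y x. f (Complex x y)) (upper_trace \<beta> f) (at_left \<beta>)"
proof -
  obtain K where "\<And>y. \<bar>y\<bar> < \<beta> \<Longrightarrow> line_energy f y \<le> K"
    using line_energy_bounded[OF f] by blast
  then obtain L where L: "(line_energy f \<longlongrightarrow> L) (at_left \<beta>)"
    using convex_on_bounded_has_left_limit[OF \<beta> line_energy_convex[OF f]] by blast
  have "\<exists>g. L2_tendsto lborel (\<lambda>y x. f (Complex x y)) g (at_left \<beta>)"
  proof (rule strip_lines_convergent[OF f _ _ L])
    show "\<forall>\<^sub>F y in at_left \<beta>. \<bar>y\<bar> < \<beta>"
      using eventually_at_left_real[of "- \<beta>" \<beta>] \<beta> by (auto elim!: eventually_mono)
    fix P assume "eventually P (at_left \<beta>)"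
    then obtain b where b: "b < \<beta>" "\<And>y. b < y \<Longrightarrow> y < \<beta> \<Longrightarrow> P y"
      using eventually_at_left[of "\<beta> - 1" \<beta>] by auto
    then show "\<exists>Q. eventually Q (at_left \<beta>) \<and> (\<forall>y y'. Q y \<longrightarrow> Q y' \<longrightarrow> P ((y + y') / 2))"
      by (intro exI[of _ "\<lambda>y. y \<in> {b<..<\<beta>}"] conjI eventually_at_left_real) auto
  qed simp
  then show ?thesis unfolding upper_trace_def by (rule someI_ex)
qed

lemma lower_trace:
  assumes f: "f \<in> H2_strip \<beta>" and \<beta>: "\<beta> > 0"
  shows "L2_tendsto lborel (\<lambda>y x. f (Complex x y)) (lower_trace \<beta> f) (at_right (- \<beta>))"
proof -
  obtain K where "\<And>y. \<bar>y\<bar> < \<beta> \<Longrightarrow> line_energy f y \<le> K"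
    using line_energy_bounded[OF f] by blast
  then obtain L where L: "(line_energy f \<longlongrightarrow> L) (at_right (- \<beta>))"
    using convex_on_bounded_has_right_limit[OF \<beta> line_energy_convex[OF f]] by blast
  have "\<exists>g. L2_tendsto lborel (\<lambda>y x. f (Complex x y)) g (at_right (- \<beta>))"
  proof (rule strip_lines_convergent[OF f _ _ L])
    show "\<forall>\<^sub>F y in at_right (- \<beta>). \<bar>y\<bar> < \<beta>"
      using eventually_at_right_real[of "- \<beta>" \<beta>] \<beta> by (auto elim!: eventually_mono)
    fix P assume "eventually P (at_right (- \<beta>))"
    then obtain b where b: "- \<beta> < b" "\<And>y. - \<beta> < y \<Longrightarrow> y < b \<Longrightarrow> P y"
      using eventually_at_right[of "- \<beta>" "1 - \<beta>"] by auto
    then show "\<exists>Q. eventually Q (at_right (- \<beta>)) \<and> (\<forall>y y'. Q y \<longrightarrow> Q y' \<longrightarrow> P ((y + y') / 2))"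
      by (intro exI[of _ "\<lambda>y. y \<in> {- \<beta><..<b}"] conjI eventually_at_right_real) auto
  qed simp
  then show ?thesis unfolding lower_trace_def by (rule someI_ex)
qed

text \<open>The midpoint identity with \<open>y' = y\<^sub>0\<close> reduces this to the continuity of a convex function.\<close>

lemma strip_lines_continuous:
  assumes f: "f \<in> H2_strip \<beta>" and y0: "\<bar>y0\<bar> < \<beta>"
  shows "L2_tendsto lborel (\<lambda>y x. f (Complex x y)) (\<lambda>x. f (Complex x y0)) (nhds y0)"
proof -
  have "continuous_on {-\<beta><..<\<beta>} (line_energy f)"
    by (intro convex_on_continuous line_energy_convex[OF f]) simp
  then have cont: "isCont (line_energy f) y0"
    using y0 by (auto simp: continuous_on_eq_continuous_at abs_less_iff)
  have lim: "(line_energy f \<longlongrightarrow> line_energy f y0) (nhds y0)"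
    using cont by (simp add: continuous_at tendsto_at_iff_tendsto_nhds)
  have "((\<lambda>y. (y + y0) / 2) \<longlongrightarrow> (y0 + y0) / 2) (nhds y0)"
    by (intro tendsto_intros filterlim_ident) auto
  then have lim_mid: "((\<lambda>y. line_energy f ((y + y0) / 2)) \<longlongrightarrow> line_energy f y0) (nhds y0)"
    by (intro filterlim_compose[OF lim]) simp
  have "((\<lambda>y. ennreal (line_energy f y + line_energy f y0 - 2 * line_energy f ((y + y0) / 2)))
      \<longlongrightarrow> ennreal (line_energy f y0 + line_energy f y0 - 2 * line_energy f y0)) (nhds y0)"
    by (intro tendsto_intros lim lim_mid)
  moreover have inside: "\<forall>\<^sub>F y in nhds y0. y \<in> {-\<beta><..<\<beta>}"
    using y0 by (intro eventually_nhds_in_open) auto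
  then have "\<forall>\<^sub>F y in nhds y0.
      ennreal (line_energy f y + line_energy f y0 - 2 * line_energy f ((y + y0) / 2))
      = L2_sq lborel (\<lambda>x. f (Complex x y) - f (Complex x y0))"
    by eventually_elim (use y0 in \<open>simp add: strip_midpoint_identity(1)[OF f] abs_less_iff\<close>)
  ultimately have "((\<lambda>y. L2_sq lborel (\<lambda>x. f (Complex x y) - f (Complex x y0))) \<longlongrightarrow> 0) (nhds y0)"
    by (auto elim: Lim_transform_eventually)
  moreover have "\<forall>\<^sub>F y in nhds y0. (\<lambda>x. f (Complex x y)) \<in> L2 lborel"
    using inside by eventually_elim (auto intro: H2_strip_line_L2[OF f])
  ultimately show ?thesis
    using H2_strip_line_L2[OF f y0] by (simp add: L2_tendsto_def)
qed

lemma L2_tendsto_compose: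
  assumes "L2_tendsto M u g B" "filterlim h B A"
  shows "L2_tendsto M (\<lambda>i. u (h i)) g A"
  using assms unfolding L2_tendsto_def
  by (auto intro: eventually_compose_filterlim filterlim_compose)

section \<open>Fourier series on the cylinder\<close>

abbreviation circle :: "real measure" where
  "circle \<equiv> restrict_space lborel {0..<1}"

lemma finite_measure_circle: "finite_measure circle"
  by (intro finite_measureI) (simp add: emeasure_restrict_space)

lemma integral_circle_cis:
  "(\<integral>\<theta>. cis (2 * pi * \<theta>) powi n \<partial>circle) = (if n = 0 then 1 else 0)"
proof -
  have "(\<integral>\<theta>. cis (2 * pi * \<theta>) powi n \<partial>circle)
      = (\<integral>\<theta>. indicator {0..<1} \<theta> *\<^sub>R (cis (2 * pi * \<theta>) powi n) \<partial>lborel)"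
    by (subst integral_restrict_space) auto
  also have "\<dots> = (\<integral>\<theta>. indicator {0..1} \<theta> *\<^sub>R (cis (2 * pi * \<theta>) powi n) \<partial>lborel)"
  proof (rule integral_cong_AE)
    have *: "(\<lambda>\<theta>. cis (2 * pi * \<theta>) powi n) \<in> borel_measurable borel"
      unfolding cis_power_int by (intro borel_measurable_continuous_onI continuous_intros)
    then show "(\<lambda>\<theta>. indicator {0..<1} \<theta> *\<^sub>R (cis (2 * pi * \<theta>) powi n)) \<in> borel_measurable lborel"
      "(\<lambda>\<theta>. indicator {0..1} \<theta> *\<^sub>R (cis (2 * pi * \<theta>) powi n)) \<in> borel_measurable lborel"
      by auto
    show "AE \<theta> in lborel. indicator {0..<1} \<theta> *\<^sub>R (cis (2 * pi * \<theta>) powi n)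
        = indicator {0..1} \<theta> *\<^sub>R (cis (2 * pi * \<theta>) powi n)"
      using AE_lborel_singleton[of "1::real"] by eventually_elim (auto split: split_indicator)
  qed
  also have "\<dots> = (if n = 0 then 1 else 0)"
  proof (cases "n = 0")
    case True
    have "(\<integral>\<theta>. indicator {0..1::real} \<theta> *\<^sub>R (1::complex) \<partial>lborel) = complex_of_real 1 - complex_of_real 0"
      by (intro integral_FTC_Icc) (auto intro!: derivative_eq_intros simp: has_vector_derivative_def
        scaleR_conv_of_real)
    with True show ?thesis by simp
  next
    case False
    define w where "w = \<i> * (2 * pi * of_int n)"
    have w: "w \<noteq> 0" using False by (simp add: w_def)
    have cis: "cis (2 * pi * \<theta>) powi n = exp (w * of_real \<theta>)" for \<theta>
      unfolding cis_power_int by (simp add: cis_conv_exp w_def mult_ac)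
    have "(\<integral>\<theta>. indicator {0..1} \<theta> *\<^sub>R exp (w * of_real \<theta>) \<partial>lborel)
        = exp (w * of_real 1) / w - exp (w * of_real 0) / w"
    proof (intro integral_FTC_Icc)
      show "((\<lambda>\<theta>. exp (w * of_real \<theta>) / w) has_vector_derivative exp (w * of_real x)) (at x within {0..1})" for x
        by (rule has_vector_derivative_real_field) (use w in \<open>auto intro!: derivative_eq_intros\<close>)
    qed (auto intro!: continuous_intros)
    also have "exp (w * of_real 1) = 1"
      using exp_integer_2pi[of "of_int n"] by (simp add: w_def mult_ac)
    finally show ?thesis using False by (simp add: cis)
  qed
  finally show ?thesis .
qed

lemma borel_measurable_circle_character [measurable]:
  "(\<lambda>\<theta>. cis (2 * pi * \<theta>) powi j) \<in> borel_measurable borel"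
  unfolding cis_power_int by (intro borel_measurable_continuous_onI continuous_intros)

lemma integrable_circle_bounded:
  fixes u :: "real \<Rightarrow> complex"
  assumes "u \<in> borel_measurable circle" "\<And>\<theta>. 0 \<le> \<theta> \<Longrightarrow> \<theta> < 1 \<Longrightarrow> cmod (u \<theta>) \<le> B"
  shows "integrable circle u"
proof -
  interpret finite_measure circle by (rule finite_measure_circle)
  show ?thesis
    using assms by (intro integrable_const_bound[where B = B] AE_I2) (auto simp: space_restrict_space)
qed

lemma parseval_finite:
  fixes c :: "int \<Rightarrow> complex"
  assumes J: "finite J"
  shows "(\<integral>\<theta>. complex_of_real ((cmod (\<Sum>j\<in>J. c j * cis (2 * pi * \<theta>) powi j))\<^sup>2) \<partial>circle)
    = (\<Sum>j\<in>J. complex_of_real ((cmod (c j))\<^sup>2))"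
proof -
  have expand: "complex_of_real ((cmod (\<Sum>j\<in>J. c j * cis (2 * pi * \<theta>) powi j))\<^sup>2)
      = (\<Sum>j\<in>J. \<Sum>k\<in>J. (c j * cnj (c k)) * cis (2 * pi * \<theta>) powi (j - k))" for \<theta>
    unfolding complex_norm_square cnj_sum sum_product
    by (intro sum.cong refl) (simp add: cis_power_int cis_mult algebra_simps cis_cnj)
  have meas: "(\<lambda>\<theta>. cis (2 * pi * \<theta>) powi n) \<in> borel_measurable circle" for n
    by (rule measurable_restrict_space1) simp
  have int: "integrable circle (\<lambda>\<theta>. cis (2 * pi * \<theta>) powi n)" for n
    by (rule integrable_circle_bounded[OF meas, where B = 1]) (simp add: norm_power_int)
  have "(\<integral>\<theta>. complex_of_real ((cmod (\<Sum>j\<in>J. c j * cis (2 * pi * \<theta>) powi j))\<^sup>2) \<partial>circle)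
      = (\<Sum>j\<in>J. \<Sum>k\<in>J. (c j * cnj (c k)) * (if j - k = 0 then 1 else 0))"
    unfolding expand
    by (simp only: Bochner_Integration.integral_sum Bochner_Integration.integrable_sum int
        integrable_mult_right integral_mult_right_zero integral_circle_cis)
  also have "\<dots> = (\<Sum>j\<in>J. complex_of_real ((cmod (c j))\<^sup>2))"
    using J unfolding complex_norm_square by (intro sum.cong refl) (simp add: if_distrib cong: if_cong)
  finally show ?thesis .
qed

abbreviation sym_interval :: "nat \<Rightarrow> int set" where
  "sym_interval n \<equiv> {- int n..int n}"

lemma eventually_mem_sym_interval: "\<forall>\<^sub>F n in sequentially. j \<in> sym_interval n"
  using eventually_ge_at_top[of "nat \<bar>j\<bar>"] by eventually_elim auto

lemma filterlim_sym_interval: "filterlim sym_interval (finite_subsets_at_top UNIV) sequentially"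
  unfolding filterlim_finite_subsets_at_top
proof (intro allI impI)
  fix X :: "int set" assume "finite X \<and> X \<subseteq> UNIV"
  then have "\<forall>\<^sub>F n in sequentially. \<forall>j\<in>X. j \<in> sym_interval n"
    by (intro eventually_ball_finite) (auto simp: eventually_mem_sym_interval simp del: atLeastAtMost_iff)
  then show "\<forall>\<^sub>F n in sequentially. finite (sym_interval n) \<and> X \<subseteq> sym_interval n \<and> sym_interval n \<subseteq> UNIV"
    by eventually_elim auto
qed

lemma sum_sym_interval_tendsto:
  fixes a :: "int \<Rightarrow> ennreal"
  shows "(\<lambda>n. \<Sum>j\<in>sym_interval n. a j) \<longlonglongrightarrow> (\<integral>\<^sup>+j. a j \<partial>count_space UNIV)"
proof -
  have "(\<lambda>n. \<integral>\<^sup>+j. a j * indicator (sym_interval n) j \<partial>count_space UNIV)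
      \<longlonglongrightarrow> (\<integral>\<^sup>+j. a j \<partial>count_space UNIV)"
  proof (rule nn_integral_LIMSEQ)
    show "incseq (\<lambda>n j. a j * indicator (sym_interval n) j)"
      by (auto simp: incseq_def le_fun_def split: split_indicator)
    show "(\<lambda>n. a j * indicator (sym_interval n) j) \<longlonglongrightarrow> a j" for j
      by (rule Lim_transform_eventually[OF tendsto_const])
        (use eventually_mem_sym_interval[of j] in \<open>eventually_elim, simp\<close>)
  qed simp
  moreover have "(\<integral>\<^sup>+j. a j * indicator (sym_interval n) j \<partial>count_space UNIV)
      = (\<Sum>j\<in>sym_interval n. a j)" for n
    by (subst nn_integral_count_space'[of "sym_interval n"]) (auto intro!: sum.cong)
  ultimately show ?thesis by simp
qed

text \<open>Absolute summability makes the partial sums uniformly bounded, so that the finite identity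
  passes to the limit by dominated convergence.\<close>

lemma parseval_circle:
  fixes c :: "int \<Rightarrow> complex"
  assumes u: "\<And>\<theta>. 0 \<le> \<theta> \<Longrightarrow> \<theta> < 1 \<Longrightarrow> ((\<lambda>j. c j * cis (2 * pi * \<theta>) powi j) has_sum u \<theta>) UNIV"
  shows "(\<integral>\<^sup>+\<theta>. ennreal ((cmod (u \<theta>))\<^sup>2) \<partial>circle)
    = (\<integral>\<^sup>+j. ennreal ((cmod (c j))\<^sup>2) \<partial>count_space UNIV)"
proof -
  define S where "S n \<theta> = (\<Sum>j\<in>sym_interval n. c j * cis (2 * pi * \<theta>) powi j)" for n \<theta>
  define C where "C = (\<Sum>\<^sub>\<infinity>j. cmod (c j))"
  have "c summable_on UNIV"
    \<comment> \<open>At \<open>\<theta> = 0\<close> all characters are \<open>1\<close>.\<close>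
    using u[of 0] by (auto simp: summable_on_def)
  then have abs: "(\<lambda>j. cmod (c j)) summable_on UNIV"
    by (simp add: summable_on_iff_abs_summable_on_complex)
  have S_le: "cmod (S n \<theta>) \<le> C" for n \<theta>
  proof -
    have "cmod (S n \<theta>) \<le> (\<Sum>j\<in>sym_interval n. cmod (c j))"
      unfolding S_def by (rule sum_norm_le) (simp add: norm_mult norm_power_int)
    also have "\<dots> \<le> C"
      unfolding C_def by (rule finite_sum_le_infsum[OF abs]) auto
    finally show ?thesis .
  qed
  have S_lim: "(\<lambda>n. S n \<theta>) \<longlonglongrightarrow> u \<theta>" if "0 \<le> \<theta>" "\<theta> < 1" for \<theta>
    using filterlim_compose[OF u[OF that, unfolded has_sum_def] filterlim_sym_interval]
    by (simp add: S_def)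
  have S_meas: "S n \<in> borel_measurable circle" for n
    unfolding S_def[abs_def] by (rule measurable_restrict_space1) simp
  have u_meas: "u \<in> borel_measurable circle"
    by (rule borel_measurable_LIMSEQ_metric[OF S_meas])
      (auto simp: space_restrict_space intro!: S_lim)
  interpret finite_measure circle by (rule finite_measure_circle)
  have "(\<lambda>n. \<integral>\<theta>. (cmod (S n \<theta>))\<^sup>2 \<partial>circle) \<longlonglongrightarrow> (\<integral>\<theta>. (cmod (u \<theta>))\<^sup>2 \<partial>circle)"
  proof (rule integral_dominated_convergence[where w = "\<lambda>_. C\<^sup>2"])
    show "AE \<theta> in circle. (\<lambda>n. (cmod (S n \<theta>))\<^sup>2) \<longlonglongrightarrow> (cmod (u \<theta>))\<^sup>2"
      by (rule AE_I2) (auto simp: space_restrict_space intro!: tendsto_intros S_lim)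
    show "AE \<theta> in circle. norm ((cmod (S n \<theta>))\<^sup>2) \<le> C\<^sup>2" for n
      by (rule AE_I2) (simp add: S_le power_mono)
  qed (use u_meas S_meas in auto)
  moreover have "(\<integral>\<theta>. (cmod (S n \<theta>))\<^sup>2 \<partial>circle) = (\<Sum>j\<in>sym_interval n. (cmod (c j))\<^sup>2)" for n
  proof -
    have "complex_of_real (\<integral>\<theta>. (cmod (S n \<theta>))\<^sup>2 \<partial>circle)
        = complex_of_real (\<Sum>j\<in>sym_interval n. (cmod (c j))\<^sup>2)"
      using parseval_finite[of "sym_interval n" c]
      by (simp only: S_def integral_complex_of_real of_real_sum finite_atLeastAtMost_int)
    then show ?thesis by (simp only: of_real_eq_iff)
  qed
  ultimately have "(\<lambda>n. \<Sum>j\<in>sym_interval n. (cmod (c j))\<^sup>2) \<longlonglongrightarrow> (\<integral>\<theta>. (cmod (u \<theta>))\<^sup>2 \<partial>circle)"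
    by simp
  from tendsto_ennrealI[OF this]
  have "(\<lambda>n. \<Sum>j\<in>sym_interval n. ennreal ((cmod (c j))\<^sup>2))
      \<longlonglongrightarrow> ennreal (\<integral>\<theta>. (cmod (u \<theta>))\<^sup>2 \<partial>circle)"
    by (simp add: sum_ennreal)
  from LIMSEQ_unique[OF this sum_sym_interval_tendsto]
  have "ennreal (\<integral>\<theta>. (cmod (u \<theta>))\<^sup>2 \<partial>circle) = (\<integral>\<^sup>+j. ennreal ((cmod (c j))\<^sup>2) \<partial>count_space UNIV)" .
  moreover have "integrable circle (\<lambda>\<theta>. (cmod (u \<theta>))\<^sup>2)"
  proof (rule integrable_const_bound[where B = "C\<^sup>2"])
    show "AE \<theta> in circle. norm ((cmod (u \<theta>))\<^sup>2) \<le> C\<^sup>2"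
    proof (rule AE_I2)
      fix \<theta> assume "\<theta> \<in> space circle"
      then have "cmod (u \<theta>) \<le> C"
        by (intro LIMSEQ_le_const2[OF tendsto_norm[OF S_lim]])
          (auto simp: space_restrict_space S_le)
      then show "norm ((cmod (u \<theta>))\<^sup>2) \<le> C\<^sup>2" by (simp add: power_mono)
    qed
  qed (use u_meas in auto)
  ultimately show ?thesis
    by (subst nn_integral_eq_integral) auto
qed

text \<open>Convergence is required everywhere, not in \<open>L\<^sup>2\<close>.  For numerical series this means absolute
  summability, so measurability of \<open>u\<close> and Parseval's identity both follow.\<close>

definition has_fourier_series :: "(real \<times> real \<Rightarrow> complex) \<Rightarrow> (int \<Rightarrow> real \<Rightarrow> complex) \<Rightarrow> bool" where
  "has_fourier_series u c \<longleftrightarrow> (\<forall>x. \<forall>\<theta>\<in>{0..<1}.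
     ((\<lambda>j. c j x * cis (2 * pi * \<theta>) powi j) has_sum u (x, \<theta>)) UNIV)"

definition trig_sum :: "int set \<Rightarrow> (int \<Rightarrow> real \<Rightarrow> complex) \<Rightarrow> real \<times> real \<Rightarrow> complex" where
  "trig_sum J c p = (\<Sum>j\<in>J. c j (fst p) * cis (2 * pi * snd p) powi j)"

lemma has_fourier_series_diff:
  assumes "has_fourier_series u c" "has_fourier_series v d"
  shows "has_fourier_series (\<lambda>p. u p - v p) (\<lambda>j x. c j x - d j x)"
  unfolding has_fourier_series_def
proof (intro allI ballI)
  fix x \<theta> :: real assume \<theta>: "\<theta> \<in> {0..<1}"
  let ?e = "\<lambda>j. cis (2 * pi * \<theta>) powi j"
  have "((\<lambda>j. c j x * ?e j + - (d j x * ?e j)) has_sum (u (x, \<theta>) + - v (x, \<theta>))) UNIV"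
    using assms \<theta> unfolding has_fourier_series_def by (intro has_sum_add has_sum_uminusI) auto
  then show "((\<lambda>j. (c j x - d j x) * ?e j) has_sum (u (x, \<theta>) - v (x, \<theta>))) UNIV"
    by (simp add: algebra_simps)
qed

lemma has_fourier_series_trig_sum:
  assumes "finite J"
  shows "has_fourier_series (trig_sum J c) (\<lambda>j x. if j \<in> J then c j x else 0)"
  unfolding has_fourier_series_def trig_sum_def
  by (intro allI ballI has_sum_finite_neutralI[of J]) (use assms in auto)

lemma trig_sum_measurable:
  assumes "\<And>j. j \<in> J \<Longrightarrow> c j \<in> borel_measurable lborel"
  shows "trig_sum J c \<in> borel_measurable cylinder"
proof -
  have "(\<lambda>p. cis (2 * pi * snd p) powi j) \<in> borel_measurable cylinder" for j
    unfolding cylinder_def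
    by (rule measurable_compose[OF measurable_snd], rule measurable_restrict_space1) simp
  moreover have "(\<lambda>p. c j (fst p)) \<in> borel_measurable cylinder" if "j \<in> J" for j
    unfolding cylinder_def by (rule measurable_compose[OF measurable_fst]) (rule assms[OF that])
  ultimately show ?thesis
    unfolding trig_sum_def[abs_def] by (intro borel_measurable_sum borel_measurable_times) auto
qed

lemma has_fourier_series_measurable:
  assumes u: "has_fourier_series u c" and c: "\<And>j. c j \<in> borel_measurable lborel"
  shows "u \<in> borel_measurable cylinder"
proof (rule borel_measurable_LIMSEQ_metric)
  show "trig_sum (sym_interval n) c \<in> borel_measurable cylinder" for n
    using c by (rule trig_sum_measurable)
  fix p assume "p \<in> space cylinder"
  then obtain x \<theta> where p: "p = (x, \<theta>)" "\<theta> \<in> {0..<1}"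
    by (cases p) (auto simp: cylinder_def space_pair_measure space_restrict_space)
  then have "((\<lambda>j. c j x * cis (2 * pi * \<theta>) powi j) has_sum u (x, \<theta>)) UNIV"
    using u by (auto simp: has_fourier_series_def)
  from filterlim_compose[OF this[unfolded has_sum_def] filterlim_sym_interval]
  show "(\<lambda>n. trig_sum (sym_interval n) c p) \<longlonglongrightarrow> u p"
    by (simp add: trig_sum_def p)
qed

lemma parseval_cylinder:
  assumes u: "has_fourier_series u c" and c: "\<And>j. c j \<in> borel_measurable lborel"
  shows "L2_sq cylinder u = (\<integral>\<^sup>+j. L2_sq lborel (c j) \<partial>count_space UNIV)"
proof -
  interpret circle: finite_measure circle by (rule finite_measure_circle)
  note u_meas = has_fourier_series_measurable[OF u c]
  have [measurable]: "c j \<in> borel_measurable borel" for j using c[of j] by simp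
  have "L2_sq cylinder u = (\<integral>\<^sup>+x. \<integral>\<^sup>+\<theta>. ennreal ((cmod (u (x, \<theta>)))\<^sup>2) \<partial>circle \<partial>lborel)"
    using u_meas unfolding L2_sq_def cylinder_def
    by (subst circle.nn_integral_fst) auto
  also have "\<dots> = (\<integral>\<^sup>+x. \<integral>\<^sup>+j. ennreal ((cmod (c j x))\<^sup>2) \<partial>count_space UNIV \<partial>lborel)"
    by (intro nn_integral_cong parseval_circle) (use u in \<open>auto simp: has_fourier_series_def\<close>)
  also have "\<dots> = (\<integral>\<^sup>+j. L2_sq lborel (c j) \<partial>count_space UNIV)"
    unfolding L2_sq_def by (subst nn_integral_count_space_nn_integral) auto
  finally show ?thesis .
qed

lemma nn_integral_tail_small:
  fixes \<alpha> :: "int \<Rightarrow> ennreal"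
  assumes "(\<integral>\<^sup>+j. \<alpha> j \<partial>count_space UNIV) < \<infinity>" "e > 0"
  shows "\<exists>J. finite J \<and> (\<integral>\<^sup>+j. \<alpha> j * indicator (- J) j \<partial>count_space UNIV) < e"
proof -
  have "(\<lambda>n. \<integral>\<^sup>+j. \<alpha> j * indicator (- sym_interval n) j \<partial>count_space UNIV)
      \<longlonglongrightarrow> (\<integral>\<^sup>+j. 0 \<partial>count_space (UNIV :: int set))"
  proof (rule nn_integral_dominated_convergence[where w = \<alpha>])
    show "AE j in count_space UNIV. (\<lambda>n. \<alpha> j * indicator (- sym_interval n) j) \<longlonglongrightarrow> 0"
    proof (rule AE_I2)
      fix j
      have "\<forall>\<^sub>F n in sequentially. 0 = \<alpha> j * indicator (- sym_interval n) j"
        using eventually_mem_sym_interval[of j] by eventually_elim simp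
      then show "(\<lambda>n. \<alpha> j * indicator (- sym_interval n) j) \<longlonglongrightarrow> 0"
        by (rule Lim_transform_eventually[OF tendsto_const])
    qed
  qed (use assms in \<open>auto split: split_indicator\<close>)
  then have "\<forall>\<^sub>F n in sequentially.
      (\<integral>\<^sup>+j. \<alpha> j * indicator (- sym_interval n) j \<partial>count_space UNIV) < e"
    using assms(2) by (intro order_tendstoD) auto
  then obtain n where "(\<integral>\<^sup>+j. \<alpha> j * indicator (- sym_interval n) j \<partial>count_space UNIV) < e"
    by (auto simp: eventually_sequentially)
  then show ?thesis by (intro exI[of _ "sym_interval n"]) auto
qed

lemma L2_sq_zero [simp]: "L2_sq M (\<lambda>x. 0) = 0"
  by (simp add: L2_sq_def)

lemma L2_sq_trig_sum:
  assumes J: "finite J" and c: "\<And>j. j \<in> J \<Longrightarrow> c j \<in> borel_measurable lborel"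
  shows "L2_sq cylinder (trig_sum J c) = (\<Sum>j\<in>J. L2_sq lborel (c j))"
proof -
  have "L2_sq cylinder (trig_sum J c)
      = (\<integral>\<^sup>+j. L2_sq lborel (\<lambda>x. if j \<in> J then c j x else 0) \<partial>count_space UNIV)"
  proof (rule parseval_cylinder[OF has_fourier_series_trig_sum[OF J]])
    show "(\<lambda>x. if j \<in> J then c j x else 0) \<in> borel_measurable lborel" for j
      using c[of j] by (cases "j \<in> J") auto
  qed
  also have "\<dots> = (\<Sum>j\<in>J. L2_sq lborel (c j))"
    using J by (subst nn_integral_count_space'[of J]) (auto intro!: sum.cong)
  finally show ?thesis .
qed

lemma trig_sum_L2:
  assumes J: "finite J" and c: "\<And>j. j \<in> J \<Longrightarrow> c j \<in> L2 lborel"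
  shows "trig_sum J c \<in> L2 cylinder"
proof -
  have "L2_sq cylinder (trig_sum J c) = (\<Sum>j\<in>J. L2_sq lborel (c j))"
    by (intro L2_sq_trig_sum J L2_measurable c)
  also have "\<dots> < \<infinity>"
    using J L2_sq_finite[OF c] by (simp add: ennreal_sum_less_top)
  finally have "L2_sq cylinder (trig_sum J c) < \<infinity>" .
  then show ?thesis
    using trig_sum_measurable[of J c] L2_measurable[OF c] by (auto simp: L2_def)
qed

lemma L2_sq_fourier_series_diff_trig_sum_le:
  assumes u: "has_fourier_series u c" and c: "\<And>j. c j \<in> borel_measurable lborel"
    and J: "finite J" and le: "\<And>j. L2_sq lborel (c j) \<le> \<alpha> j"
  shows "L2_sq cylinder (\<lambda>p. u p - trig_sum J c p)
    \<le> (\<integral>\<^sup>+j. \<alpha> j * indicator (- J) j \<partial>count_space UNIV)"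
proof -
  have "L2_sq cylinder (\<lambda>p. u p - trig_sum J c p)
      = (\<integral>\<^sup>+j. L2_sq lborel (\<lambda>x. c j x - (if j \<in> J then c j x else 0)) \<partial>count_space UNIV)"
  proof (rule parseval_cylinder[OF has_fourier_series_diff[OF u has_fourier_series_trig_sum[OF J]]])
    show "(\<lambda>x. c j x - (if j \<in> J then c j x else 0)) \<in> borel_measurable lborel" for j
      using c[of j] by (cases "j \<in> J") auto
  qed
  also have "\<dots> \<le> (\<integral>\<^sup>+j. \<alpha> j * indicator (- J) j \<partial>count_space UNIV)"
  proof (rule nn_integral_mono)
    show "L2_sq lborel (\<lambda>x. c j x - (if j \<in> J then c j x else 0)) \<le> \<alpha> j * indicator (- J) j" for j
      using le[of j] by (cases "j \<in> J") auto
  qed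
  finally show ?thesis .
qed

lemma trig_sum_diff: "trig_sum J (\<lambda>j x. c j x - d j x) p = trig_sum J c p - trig_sum J d p"
  by (simp add: trig_sum_def sum_subtractf left_diff_distrib)

text \<open>Beyond a finite set \<open>J\<^sub>0\<close> with small tail, all partial sums are close to the one over \<open>J\<^sub>0\<close>.\<close>

lemma trig_sum_convergent:
  assumes c: "\<And>j. c j \<in> L2 lborel"
    and sum: "(\<integral>\<^sup>+j. L2_sq lborel (c j) \<partial>count_space UNIV) < \<infinity>"
  shows "\<exists>G. L2_tendsto cylinder (\<lambda>J. trig_sum J c) G (finite_subsets_at_top UNIV)"
proof (rule L2_complete)
  show "\<forall>\<^sub>F J in finite_subsets_at_top UNIV. trig_sum J c \<in> L2 cylinder"
    by (rule eventually_finite_subsets_at_top_weakI) (auto intro: trig_sum_L2 c)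
  fix e :: real assume e: "e > 0"
  then obtain J0 where J0: "finite J0"
    "(\<integral>\<^sup>+j. L2_sq lborel (c j) * indicator (- J0) j \<partial>count_space UNIV) < ennreal (e / 4)"
    using nn_integral_tail_small[OF sum, of "ennreal (e / 4)"] by auto
  have close: "L2_sq cylinder (\<lambda>p. trig_sum J c p - trig_sum J0 c p) \<le> ennreal (e / 4)"
    if J: "finite J" "J0 \<subseteq> J" for J
  proof -
    have "L2_sq cylinder (\<lambda>p. trig_sum J c p - trig_sum J0 c p)
        = L2_sq cylinder (trig_sum (J - J0) c)"
      unfolding trig_sum_def using J by (simp add: sum_diff)
    also have "\<dots> = (\<Sum>j\<in>J - J0. L2_sq lborel (c j))"
      using J by (intro L2_sq_trig_sum L2_measurable c) auto
    also have "\<dots> = (\<integral>\<^sup>+j. L2_sq lborel (c j) * indicator (J - J0) j \<partial>count_space UNIV)"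
      using J by (subst nn_integral_count_space'[of "J - J0"]) (auto intro!: sum.cong)
    also have "\<dots> \<le> (\<integral>\<^sup>+j. L2_sq lborel (c j) * indicator (- J0) j \<partial>count_space UNIV)"
      by (intro nn_integral_mono) (auto split: split_indicator)
    finally show ?thesis using J0(2) by simp
  qed
  have "L2_sq cylinder (\<lambda>p. trig_sum J c p - trig_sum K c p) \<le> ennreal e"
    if J: "finite J \<and> J0 \<subseteq> J" and K: "finite K \<and> J0 \<subseteq> K" for J K
  proof -
    have "L2_sq cylinder (\<lambda>p. trig_sum J c p - trig_sum K c p)
        \<le> 2 * L2_sq cylinder (\<lambda>p. trig_sum J c p - trig_sum J0 c p)
          + 2 * L2_sq cylinder (\<lambda>p. trig_sum J0 c p - trig_sum K c p)"
      by (intro L2_sq_triangle trig_sum_measurable L2_measurable c)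
    also have "\<dots> \<le> 2 * ennreal (e / 4) + 2 * ennreal (e / 4)"
      using J K close by (intro add_mono mult_left_mono)
        (auto simp: L2_sq_diff_commute[of _ "trig_sum J0 c"])
    also have "\<dots> = ennreal (2 * (e / 4) + 2 * (e / 4))"
      using e by (simp only: ennreal_plus ennreal_mult)(simp add: ennreal_mult)
    also have "\<dots> = ennreal e" by simp
    finally show ?thesis .
  qed
  moreover have "\<forall>\<^sub>F J in finite_subsets_at_top UNIV. finite J \<and> J0 \<subseteq> J"
    using J0(1) by (auto simp: eventually_finite_subsets_at_top intro!: exI[of _ J0])
  ultimately show "\<exists>P. eventually P (finite_subsets_at_top UNIV) \<and>
      (\<forall>J K. P J \<longrightarrow> P K \<longrightarrow> L2_sq cylinder (\<lambda>p. trig_sum J c p - trig_sum K c p) \<le> ennreal e)"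
    by (intro exI[of _ "\<lambda>J. finite J \<and> J0 \<subseteq> J"]) blast
qed simp

text \<open>Choose a finite set \<open>J\<close> of modes outside of which the majorant \<open>\<alpha>\<close> is small.  The distance
  from \<open>u i\<close> to \<open>G\<close> is split into the tail of \<open>u i\<close>, the finitely many modes in \<open>J\<close>, which
  converge, and the tail of \<open>G\<close>.\<close>

lemma fourier_series_dominated_convergence:
  fixes c :: "'i \<Rightarrow> int \<Rightarrow> real \<Rightarrow> complex"
  assumes u: "\<forall>\<^sub>F i in A. has_fourier_series (u i) (c i)
      \<and> (\<forall>j. c i j \<in> L2 lborel \<and> L2_sq lborel (c i j) \<le> \<alpha> j)"
    and \<alpha>: "(\<integral>\<^sup>+j. \<alpha> j \<partial>count_space UNIV) < \<infinity>"
    and c: "\<And>j. L2_tendsto lborel (\<lambda>i. c i j) (d j) A"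
    and G: "L2_tendsto cylinder (\<lambda>J. trig_sum J d) G (finite_subsets_at_top UNIV)"
  shows "L2_tendsto cylinder u G A"
proof -
  have d_L2: "d j \<in> L2 lborel" for j using c[of j] by (simp add: L2_tendsto_def)
  have G_L2: "G \<in> L2 cylinder" using G by (simp add: L2_tendsto_def)
  have u_meas: "u i \<in> borel_measurable cylinder"
    if "has_fourier_series (u i) (c i)" "\<forall>j. c i j \<in> L2 lborel \<and> L2_sq lborel (c i j) \<le> \<alpha> j" for i
    using that by (auto intro: has_fourier_series_measurable L2_measurable)
  have "\<forall>\<^sub>F i in A. u i \<in> L2 cylinder"
    using u
  proof eventually_elim
    case (elim i)
    then have "L2_sq cylinder (u i) = (\<integral>\<^sup>+j. L2_sq lborel (c i j) \<partial>count_space UNIV)"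
      by (intro parseval_cylinder L2_measurable) auto
    also have "\<dots> \<le> (\<integral>\<^sup>+j. \<alpha> j \<partial>count_space UNIV)"
      using elim by (intro nn_integral_mono) auto
    finally show ?case
      using u_meas[of i] elim \<alpha> by (auto simp: L2_def)
  qed
  moreover have "((\<lambda>i. L2_sq cylinder (\<lambda>p. u i p - G p)) \<longlongrightarrow> 0) A"
  proof (rule order_tendstoI)
    fix e :: ennreal assume "0 < e"
    \<comment> \<open>Two uses of \<open>L2_sq_triangle\<close> turn three errors \<open>\<epsilon>\<close> into \<open>2 \<epsilon> + 2 (2 \<epsilon> + 2 \<epsilon>) = 10 \<epsilon>\<close>.\<close>
    then obtain \<epsilon> where \<epsilon>: "\<epsilon> > 0" "ennreal (10 * \<epsilon>) < e"
    proof (cases e)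
      case (real r)
      with \<open>0 < e\<close> show ?thesis
        by (intro that[of "r / 20"]) (auto simp: ennreal_less_iff simp del: ennreal_plus)
    next
      case top
      show ?thesis by (rule that[of 1]) (simp_all add: top less_top[symmetric] del: ennreal_plus)
    qed
    obtain J0 where J0: "finite J0"
      "(\<integral>\<^sup>+j. \<alpha> j * indicator (- J0) j \<partial>count_space UNIV) < ennreal \<epsilon>"
      using nn_integral_tail_small[OF \<alpha>, of "ennreal \<epsilon>"] \<epsilon>(1) by auto
    have "\<forall>\<^sub>F J in finite_subsets_at_top UNIV. L2_sq cylinder (\<lambda>p. trig_sum J d p - G p) < ennreal \<epsilon>"
      using G \<epsilon>(1) unfolding L2_tendsto_def by (auto intro: order_tendstoD)
    moreover have "\<forall>\<^sub>F J in finite_subsets_at_top UNIV. finite J \<and> J0 \<subseteq> J"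
      using J0(1) by (auto simp: eventually_finite_subsets_at_top intro!: exI[of _ J0])
    ultimately have "\<forall>\<^sub>F J in finite_subsets_at_top UNIV.
        L2_sq cylinder (\<lambda>p. trig_sum J d p - G p) < ennreal \<epsilon> \<and> finite J \<and> J0 \<subseteq> J"
      by (rule eventually_conj)
    then obtain J where J: "L2_sq cylinder (\<lambda>p. trig_sum J d p - G p) < ennreal \<epsilon>" "finite J" "J0 \<subseteq> J"
      using eventually_happens'[OF finite_subsets_at_top_neq_bot] by blast
    have "(\<integral>\<^sup>+j. \<alpha> j * indicator (- J) j \<partial>count_space UNIV)
        \<le> (\<integral>\<^sup>+j. \<alpha> j * indicator (- J0) j \<partial>count_space UNIV)"
      using J(3) by (intro nn_integral_mono) (auto split: split_indicator)
    with J0(2) have tail: "(\<integral>\<^sup>+j. \<alpha> j * indicator (- J) j \<partial>count_space UNIV) \<le> ennreal \<epsilon>"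
      by simp
    have "((\<lambda>i. \<Sum>j\<in>J. L2_sq lborel (\<lambda>x. c i j x - d j x)) \<longlongrightarrow> (\<Sum>j\<in>J. 0)) A"
      using c unfolding L2_tendsto_def by (intro tendsto_sum) auto
    then have "\<forall>\<^sub>F i in A. (\<Sum>j\<in>J. L2_sq lborel (\<lambda>x. c i j x - d j x)) < ennreal \<epsilon>"
      using \<epsilon>(1) by (intro order_tendstoD) auto
    with u show "\<forall>\<^sub>F i in A. L2_sq cylinder (\<lambda>p. u i p - G p) < e"
    proof eventually_elim
      case (elim i)
      then have ui: "has_fourier_series (u i) (c i)" and ci: "\<And>j. c i j \<in> L2 lborel"
        and le: "\<And>j. L2_sq lborel (c i j) \<le> \<alpha> j" by auto
      have meas: "u i \<in> borel_measurable cylinder" "trig_sum J (c i) \<in> borel_measurable cylinder"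
        "trig_sum J d \<in> borel_measurable cylinder" "G \<in> borel_measurable cylinder"
        using u_meas[of i] elim G_L2 ci d_L2 by (auto intro: trig_sum_measurable L2_measurable)
      have 1: "L2_sq cylinder (\<lambda>p. u i p - trig_sum J (c i) p) \<le> ennreal \<epsilon>"
        using L2_sq_fourier_series_diff_trig_sum_le[OF ui L2_measurable[OF ci] J(2) le] tail
        by (rule order_trans)
      have "L2_sq cylinder (trig_sum J (\<lambda>j x. c i j x - d j x))
          = (\<Sum>j\<in>J. L2_sq lborel (\<lambda>x. c i j x - d j x))"
        using J(2) by (intro L2_sq_trig_sum L2_measurable L2_diff ci d_L2)
      then have 2: "L2_sq cylinder (\<lambda>p. trig_sum J (c i) p - trig_sum J d p) \<le> ennreal \<epsilon>"
        using elim(2) by (simp add: trig_sum_diff[abs_def])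
      have "L2_sq cylinder (\<lambda>p. u i p - G p)
          \<le> 2 * L2_sq cylinder (\<lambda>p. u i p - trig_sum J (c i) p)
            + 2 * L2_sq cylinder (\<lambda>p. trig_sum J (c i) p - G p)"
        by (rule L2_sq_triangle[OF meas(1,2,4)])
      also have "\<dots> \<le> 2 * L2_sq cylinder (\<lambda>p. u i p - trig_sum J (c i) p)
            + 2 * (2 * L2_sq cylinder (\<lambda>p. trig_sum J (c i) p - trig_sum J d p)
              + 2 * L2_sq cylinder (\<lambda>p. trig_sum J d p - G p))"
        by (intro add_mono mult_left_mono L2_sq_triangle[OF meas(2-4)]) auto
      also have "\<dots> \<le> 2 * ennreal \<epsilon> + 2 * (2 * ennreal \<epsilon> + 2 * ennreal \<epsilon>)"
        using 1 2 J(1) by (intro add_mono mult_left_mono) auto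
      also have "\<dots> = ennreal (10 * \<epsilon>)"
        using \<epsilon>(1)
        by (simp only: distrib_left mult.assoc[symmetric] distrib_right[symmetric])
          (simp add: ennreal_mult)
      finally show ?case using \<epsilon>(2) by simp
    qed
  qed auto
  ultimately show ?thesis using G_L2 by (simp add: L2_tendsto_def)
qed

section \<open>Fourier modes of the slices\<close>

fun slice_height :: "real \<times> real \<Rightarrow> edge \<Rightarrow> real" where
  "slice_height (t, s) E1 = s + t"
| "slice_height (t, s) E2 = s - t"
| "slice_height (t, s) E3 = - (s + t)"
| "slice_height (t, s) E4 = - (s - t)"

abbreviation slice_corner :: "real \<Rightarrow> real \<times> real" where
  "slice_corner \<beta> \<equiv> (pi / 2, \<beta> - pi / 2)"

abbreviation slice_filter :: "real \<Rightarrow> (real \<times> real) filter" where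
  "slice_filter \<beta> \<equiv> at (slice_corner \<beta>) within slice_params \<beta>"

lemma eventually_slice_params: "\<forall>\<^sub>F p in slice_filter \<beta>. p \<in> slice_params \<beta>"
  by (simp add: eventually_at_filter)

lemma slice_height_inside: "p \<in> slice_params \<beta> \<Longrightarrow> \<bar>slice_height p l\<bar> < \<beta>"
  by (cases p; cases l) (auto simp: slice_params_def)

lemma tendsto_slice_height:
  "((\<lambda>p. slice_height p l) \<longlongrightarrow> edge_height \<beta> l) (slice_filter \<beta>)"
proof -
  have "(\<lambda>p. slice_height p l) = (\<lambda>p. case l of E1 \<Rightarrow> snd p + fst p | E2 \<Rightarrow> snd p - fst p
      | E3 \<Rightarrow> - (snd p + fst p) | E4 \<Rightarrow> - (snd p - fst p))"
    by (rule ext) (metis (no_types) prod.collapse slice_height.simps edge.case edge.exhaust)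
  then show ?thesis
    by (cases l) (auto intro!: tendsto_eq_intros)
qed

text \<open>The edges \<open>E1\<close> and \<open>E3\<close> lie on the boundary of the strip and carry the traces, while
  \<open>E2\<close> and \<open>E4\<close> lie inside because \<open>\<bar>\<beta> - \<pi>\<bar> < \<beta>\<close>.\<close>

lemma slice_lines_tendsto:
  assumes f: "f \<in> H2_strip \<beta>" and \<beta>: "\<beta> > pi / 2"
  shows "L2_tendsto lborel (\<lambda>p x. f (Complex x (slice_height p l)))
    (\<lambda>x. strip_ext \<beta> f (Complex x (edge_height \<beta> l))) (slice_filter \<beta>)"
proof -
  have \<beta>0: "\<beta> > 0" using \<beta> pi_gt_zero by linarith
  have inside: "\<forall>\<^sub>F p in slice_filter \<beta>. \<bar>slice_height p l\<bar> < \<beta>"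
    using eventually_slice_params by eventually_elim (rule slice_height_inside)
  have interior: ?thesis if l: "\<bar>edge_height \<beta> l\<bar> < \<beta>"
  proof -
    have "strip_ext \<beta> f (Complex x (edge_height \<beta> l)) = f (Complex x (edge_height \<beta> l))" for x
      using l by (auto simp: strip_ext_def)
    then show ?thesis
      using L2_tendsto_compose[OF strip_lines_continuous[OF f l] tendsto_slice_height] by simp
  qed
  show ?thesis
  proof (cases l)
    case E1
    have "filterlim (\<lambda>p. slice_height p l) (at_left \<beta>) (slice_filter \<beta>)"
      unfolding filterlim_at using inside tendsto_slice_height[of l \<beta>] E1
      by (auto elim!: eventually_mono)
    from L2_tendsto_compose[OF upper_trace[OF f \<beta>0] this] show ?thesis
      using E1 by (simp add: strip_ext_def)
  next
    case E3
    have "filterlim (\<lambda>p. slice_height p l) (at_right (- \<beta>)) (slice_filter \<beta>)"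
      unfolding filterlim_at using inside tendsto_slice_height[of l \<beta>] E3
      by (auto elim!: eventually_mono)
    from L2_tendsto_compose[OF lower_trace[OF f \<beta>0] this] show ?thesis
      using E3 \<beta>0 by (simp add: strip_ext_def)
  qed (use \<beta> interior in \<open>auto simp: abs_less_iff\<close>)
qed

text \<open>Fourier coefficients in \<open>\<theta>\<close> of the slices and of the boundary function.\<close>

definition slice_radius :: "real \<times> real \<Rightarrow> edge \<Rightarrow> real" where
  "slice_radius p l = exp (edge_sign l / 2 * snd p)"

definition slice_coeff :: "(int \<Rightarrow> complex \<Rightarrow> complex) \<Rightarrow> real \<times> real \<Rightarrow> edge \<Rightarrow> int \<Rightarrow> real \<Rightarrow> complex" where
  "slice_coeff f p l j x = complex_of_real (slice_radius p l powi j) * f j (Complex x (slice_height p l))"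

definition bdry_coeff :: "real \<Rightarrow> (int \<Rightarrow> complex \<Rightarrow> complex) \<Rightarrow> edge \<Rightarrow> int \<Rightarrow> real \<Rightarrow> complex" where
  "bdry_coeff \<beta> f l j x = complex_of_real (slice_radius (slice_corner \<beta>) l powi j)
     * strip_ext \<beta> (f j) (Complex x (edge_height \<beta> l))"

lemma slice_radius_pos: "slice_radius p l > 0"
  by (simp add: slice_radius_def)

lemma slice_coeff_L2:
  assumes "f j \<in> H2_strip \<beta>" "p \<in> slice_params \<beta>"
  shows "slice_coeff f p l j \<in> L2 lborel"
  using L2_cmult[OF H2_strip_line_L2[OF assms(1) slice_height_inside[OF assms(2)]]]
  unfolding slice_coeff_def by simp

text \<open>The weight and the line both vary with the slice; the error is
  \<open>c\<^sub>p (u\<^sub>p - g) + (c\<^sub>p - c\<^sub>0) g\<close>.\<close>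

lemma slice_coeff_tendsto:
  assumes f: "f j \<in> H2_strip \<beta>" and \<beta>: "\<beta> > pi / 2"
  shows "L2_tendsto lborel (\<lambda>p. slice_coeff f p l j) (bdry_coeff \<beta> f l j) (slice_filter \<beta>)"
proof -
  define c where "c p = complex_of_real (slice_radius p l powi j)" for p
  define u where "u p x = f j (Complex x (slice_height p l))" for p x
  define g where "g x = strip_ext \<beta> (f j) (Complex x (edge_height \<beta> l))" for x
  define c0 where "c0 = c (slice_corner \<beta>)"
  have conv: "L2_tendsto lborel u g (slice_filter \<beta>)"
    unfolding u_def g_def by (rule slice_lines_tendsto[OF f \<beta>])
  then have gL: "g \<in> L2 lborel" and uL: "\<forall>\<^sub>F p in slice_filter \<beta>. u p \<in> L2 lborel"
    and lim: "((\<lambda>p. L2_sq lborel (\<lambda>x. u p x - g x)) \<longlongrightarrow> 0) (slice_filter \<beta>)"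
    by (auto simp: L2_tendsto_def)
  have "((\<lambda>p. slice_radius p l) \<longlongrightarrow> slice_radius (slice_corner \<beta>) l) (slice_filter \<beta>)"
    unfolding slice_radius_def by (auto intro!: tendsto_eq_intros)
  then have clim: "(c \<longlongrightarrow> c0) (slice_filter \<beta>)"
    unfolding c_def c0_def using slice_radius_pos[of "slice_corner \<beta>" l] by (intro tendsto_intros) auto
  have bound: "\<forall>\<^sub>F p in slice_filter \<beta>. L2_sq lborel (\<lambda>x. c p * u p x - c0 * g x)
      \<le> 2 * (ennreal ((cmod (c p))\<^sup>2) * L2_sq lborel (\<lambda>x. u p x - g x))
        + 2 * (ennreal ((cmod (c p - c0))\<^sup>2) * L2_sq lborel g)"
    using uL
  proof eventually_elim
    case (elim p)
    have "L2_sq lborel (\<lambda>x. c p * u p x - c0 * g x)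
        = L2_sq lborel (\<lambda>x. c p * (u p x - g x) + (c p - c0) * g x)"
      by (simp add: algebra_simps)
    also have "\<dots> \<le> 2 * L2_sq lborel (\<lambda>x. c p * (u p x - g x))
        + 2 * L2_sq lborel (\<lambda>x. (c p - c0) * g x)"
      by (intro L2_sq_add_le L2_measurable L2_cmult L2_diff elim gL)
    also have "\<dots> = 2 * (ennreal ((cmod (c p))\<^sup>2) * L2_sq lborel (\<lambda>x. u p x - g x))
        + 2 * (ennreal ((cmod (c p - c0))\<^sup>2) * L2_sq lborel g)"
      by (simp only: L2_sq_cmult L2_measurable[OF L2_diff[OF elim gL]] L2_measurable[OF gL])
    finally show ?case .
  qed
  have "((\<lambda>p. 2 * (ennreal ((cmod (c p))\<^sup>2) * L2_sq lborel (\<lambda>x. u p x - g x))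
        + 2 * (ennreal ((cmod (c p - c0))\<^sup>2) * L2_sq lborel g))
      \<longlongrightarrow> 2 * (ennreal ((cmod c0)\<^sup>2) * 0) + 2 * (ennreal ((cmod (c0 - c0))\<^sup>2) * L2_sq lborel g))
      (slice_filter \<beta>)"
    using L2_sq_finite[OF gL]
    by (intro tendsto_add ennreal_tendsto_cmult tendsto_mult_ennreal tendsto_ennrealI lim
      tendsto_intros clim) auto
  then have "((\<lambda>p. L2_sq lborel (\<lambda>x. c p * u p x - c0 * g x)) \<longlongrightarrow> 0) (slice_filter \<beta>)"
    by (intro tendsto_sandwich[OF _ bound tendsto_const]) auto
  moreover have "\<forall>\<^sub>F p in slice_filter \<beta>. (\<lambda>x. c p * u p x) \<in> L2 lborel"
    using uL by eventually_elim (rule L2_cmult)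
  ultimately show ?thesis
    using L2_cmult[OF gL] unfolding L2_tendsto_def slice_coeff_def[abs_def] bdry_coeff_def[abs_def]
    by (simp add: c_def c0_def u_def g_def)
qed

section \<open>Monotonicity of the energy of a mode\<close>

text \<open>The factor \<open>e\<^bsup>-iaz/2\<^esup>\<close> has modulus \<open>e\<^bsup>ay/2\<^esup>\<close> on the line of height \<open>y\<close>.  It absorbs the weight
  \<open>e\<^bsup>ay\<^esup>\<close> into a Hardy function, so that weighted energies are convex as well.\<close>

lemma H2_strip_exp_mult:
  fixes a :: real
  assumes f: "f \<in> H2_strip \<beta>"
  shows "(\<lambda>z. exp (- \<i> * (a / 2) * z) * f z) \<in> H2_strip \<beta>"
    and "line_energy (\<lambda>z. exp (- \<i> * (a / 2) * z) * f z) y = exp (a * y) * line_energy f y"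
proof -
  define g where "g z = exp (- \<i> * (a / 2) * z) * f z" for z
  have g_sq: "(cmod (g (Complex x y)))\<^sup>2 = exp (a * y) * (cmod (f (Complex x y)))\<^sup>2" for x y
    by (simp add: g_def norm_mult power_mult_distrib norm_exp_eq_Re flip: exp_double)
  show "line_energy (\<lambda>z. exp (- \<i> * (a / 2) * z) * f z) y = exp (a * y) * line_energy f y"
    using g_sq unfolding line_energy_def g_def by simp
  obtain K where K: "K \<ge> 0" "\<And>y. \<bar>y\<bar> < \<beta> \<Longrightarrow> L2_sq lborel (\<lambda>x. f (Complex x y)) \<le> ennreal K"
    using H2_stripD(2)[OF f] by blast
  have "g \<in> H2_strip \<beta>"
  proof (rule H2_stripI)
    show "g holomorphic_on strip \<beta>"
      unfolding g_def by (intro holomorphic_intros H2_stripD(1)[OF f])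
    fix y assume y: "\<bar>y\<bar> < \<beta>"
    have "a * y \<le> \<bar>a\<bar> * \<beta>"
      using abs_ge_self[of "a * y"] mult_left_mono[of "\<bar>y\<bar>" \<beta> "\<bar>a\<bar>"] y by (simp add: abs_mult)
    have "L2_sq lborel (\<lambda>x. g (Complex x y)) = ennreal (exp (a * y)) * L2_sq lborel (\<lambda>x. f (Complex x y))"
      using L2_measurable[OF H2_strip_line_L2[OF f y]]
      by (simp add: L2_sq_def g_sq ennreal_mult nn_integral_cmult)
    also have "\<dots> \<le> ennreal (exp (\<bar>a\<bar> * \<beta>)) * ennreal K"
      using \<open>a * y \<le> \<bar>a\<bar> * \<beta>\<close> by (intro mult_mono K y ennreal_leI) auto
    finally show "L2_sq lborel (\<lambda>x. g (Complex x y)) \<le> ennreal (exp (\<bar>a\<bar> * \<beta>) * K)"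
      using K by (simp add: ennreal_mult)
  qed
  then show "(\<lambda>z. exp (- \<i> * (a / 2) * z) * f z) \<in> H2_strip \<beta>"
    by (simp add: g_def[abs_def])
qed

lemma UNIV_edge: "UNIV = {E1, E2, E3, E4}"
  using edge.exhaust by auto

instance edge :: finite
  by standard (simp add: UNIV_edge)

lemma bdry_sq_eq_sum: "bdry_sq G = (\<Sum>l\<in>UNIV. L2_sq cylinder (G l))"
  by (simp add: bdry_sq_def UNIV_edge)

definition slice_energy :: "(int \<Rightarrow> complex \<Rightarrow> complex) \<Rightarrow> int \<Rightarrow> real \<times> real \<Rightarrow> ennreal" where
  "slice_energy f j p = (\<Sum>l\<in>UNIV. L2_sq lborel (slice_coeff f p l j))"

definition bdry_energy :: "real \<Rightarrow> (int \<Rightarrow> complex \<Rightarrow> complex) \<Rightarrow> int \<Rightarrow> ennreal" where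
  "bdry_energy \<beta> f j = (\<Sum>l\<in>UNIV. L2_sq lborel (bdry_coeff \<beta> f l j))"

lemma L2_sq_slice_coeff:
  assumes f: "f j \<in> H2_strip \<beta>" and p: "p \<in> slice_params \<beta>"
  shows "L2_sq lborel (slice_coeff f p l j)
    = ennreal (exp (edge_sign l * snd p * j) * line_energy (f j) (slice_height p l))"
proof -
  have "(cmod (complex_of_real (slice_radius p l powi j)))\<^sup>2 = exp (edge_sign l * snd p * j)"
    by (simp add: slice_radius_def norm_power_int exp_power_int flip: exp_double)
  then show ?thesis
    unfolding slice_coeff_def[abs_def]
    using L2_sq_cmult[OF L2_measurable[OF H2_strip_line_L2[OF f slice_height_inside[OF p, of l]]],
        of "complex_of_real (slice_radius p l powi j)"]
      L2_sq_eq_line_energy[OF f slice_height_inside[OF p, of l]]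
    by (simp add: ennreal_mult' del: norm_of_real)
qed

text \<open>The energy of one Fourier mode on the four sides of the slice \<open>(t, s)\<close>.  For the
  mode of frequency \<open>j\<close> the exponent is \<open>a = j\<close>.\<close>

definition total_energy :: "(complex \<Rightarrow> complex) \<Rightarrow> real \<Rightarrow> real \<Rightarrow> real \<Rightarrow> real" where
  "total_energy f a t s =
     exp (a * s) * (line_energy f (s + t) + line_energy f (s - t))
     + exp (- (a * s)) * (line_energy f (- s + t) + line_energy f (- s - t))"

lemma slice_energy_eq:
  assumes f: "f j \<in> H2_strip \<beta>" and p: "(t, s) \<in> slice_params \<beta>"
  shows "slice_energy f j (t, s) = ennreal (total_energy (f j) j t s)"
proof -
  have nonneg: "line_energy g y \<ge> 0" for g y by (simp add: line_energy_def)
  show ?thesis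
    unfolding slice_energy_def UNIV_edge total_energy_def
    by (simp add: L2_sq_slice_coeff[of f, OF f p] nonneg algebra_simps flip: ennreal_plus)
qed

text \<open>For increasing \<open>t\<close>, both brackets in the definition are values of a convex function at points
  that move apart symmetrically about \<open>s\<close> and about \<open>-s\<close>.  For increasing \<open>s\<close>, the four terms are
  paired differently: in terms of \<open>N(y) = e\<^bsup>ay\<^esup> \<parallel>f\<^sub>y\<parallel>\<^sup>2\<close>, which is again convex, the sum equals
  \<open>e\<^bsup>-at\<^esup> (N(t + s) + N(t - s)) + e\<^bsup>at\<^esup> (N(-t + s) + N(-t - s))\<close>, with constant weights and
  points moving apart about \<open>t\<close> and \<open>-t\<close>.\<close>

lemma total_energy_mono:
  assumes f: "f \<in> H2_strip \<beta>"
    and t: "0 \<le> t" "t \<le> t'" and s: "0 \<le> s" "s \<le> s'" and \<beta>: "s' + t' < \<beta>"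
  shows "total_energy f a t s \<le> total_energy f a t' s'"
proof -
  note energy_sum_mono = convex_on_symmetric_sum_mono[OF line_energy_convex[OF f]]
  have "total_energy f a t s \<le> total_energy f a t' s"
    unfolding total_energy_def
    by (rule add_mono[OF mult_left_mono[OF energy_sum_mono] mult_left_mono[OF energy_sum_mono]])
      (use t s \<beta> in auto)
  also have "\<dots> \<le> total_energy f a t' s'"
  proof -
    define N where "N = line_energy (\<lambda>z. exp (- \<i> * (a / 2) * z) * f z)"
    have convex: "convex_on {-\<beta><..<\<beta>} N"
      unfolding N_def by (intro line_energy_convex H2_strip_exp_mult[OF f])
    have N: "N y = exp (a * y) * line_energy f y" for y
      unfolding N_def by (rule H2_strip_exp_mult(2)[OF f])
    have eq: "total_energy f a t' s = exp (- (a * t')) * (N (t' + s) + N (t' - s))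
        + exp (a * t') * (N (- t' + s) + N (- t' - s))" for s
    proof -
      have heights: "s + t' = t' + s" "- s - t' = - t' - s" "s - t' = - t' + s" "- s + t' = t' - s"
        by simp_all
      have regroup: "P * (A + B) + Q * (C + D) = R * (p1 * A + p2 * C) + S * (p3 * B + p4 * D)"
        if "R * p1 = P" "R * p2 = Q" "S * p3 = P" "S * p4 = Q"
        for P Q R S p1 p2 p3 p4 A B C D :: real
        by (simp only: distrib_left mult.assoc[symmetric] that)
      show ?thesis
        unfolding total_energy_def N heights
        by (rule regroup) (simp_all add: mult_exp_exp algebra_simps)
    qed
    note N_sum_mono = convex_on_symmetric_sum_mono[OF convex]
    show ?thesis
      unfolding eq
      by (rule add_mono[OF mult_left_mono[OF N_sum_mono] mult_left_mono[OF N_sum_mono]])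
        (use t s \<beta> in auto)
  qed
  finally show ?thesis .
qed

text \<open>The parameter rectangle accumulates at its corner, so inequalities survive in the limit.\<close>

lemma slice_filter_nontrivial: "\<beta> > pi / 2 \<Longrightarrow> slice_filter \<beta> \<noteq> bot"
proof -
  assume \<beta>: "\<beta> > pi / 2"
  have "slice_corner \<beta> \<in> closure (slice_params \<beta>)"
    using \<beta> by (simp add: slice_params_def closure_Times)
  moreover have "slice_corner \<beta> \<notin> slice_params \<beta>"
    by (simp add: slice_params_def)
  ultimately have "slice_corner \<beta> islimpt slice_params \<beta>"
    by (simp add: closure_def)
  then show ?thesis
    by (simp add: trivial_limit_within)
qed

lemma eventually_slice_params_ge:
  assumes "(t, s) \<in> slice_params \<beta>"
  shows "\<forall>\<^sub>F p in slice_filter \<beta>. t \<le> fst p \<and> s \<le> snd p"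
proof -
  have "((\<lambda>p. p) \<longlongrightarrow> slice_corner \<beta>) (slice_filter \<beta>)" by (rule tendsto_ident_at)
  from tendsto_fst[OF this] tendsto_snd[OF this]
  have "\<forall>\<^sub>F p in slice_filter \<beta>. t < fst p" "\<forall>\<^sub>F p in slice_filter \<beta>. s < snd p"
    using assms by (auto simp: slice_params_def intro: order_tendstoD)
  then show ?thesis by eventually_elim simp
qed

lemma slice_energy_tendsto:
  assumes "f j \<in> H2_strip \<beta>" "\<beta> > pi / 2"
  shows "((\<lambda>p. slice_energy f j p) \<longlongrightarrow> bdry_energy \<beta> f j) (slice_filter \<beta>)"
  unfolding slice_energy_def bdry_energy_def
  by (intro tendsto_sum L2_tendsto_L2_sq slice_coeff_tendsto[of f, OF assms])

text \<open>Parameters near the corner are larger in both coordinates, and the energy is increasing.\<close>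

lemma slice_energy_le_bdry_energy:
  assumes f: "f j \<in> H2_strip \<beta>" and \<beta>: "\<beta> > pi / 2" and p: "p \<in> slice_params \<beta>"
  shows "slice_energy f j p \<le> bdry_energy \<beta> f j"
proof (rule tendsto_lowerbound[OF slice_energy_tendsto[of f, OF f \<beta>]])
  obtain t s where ts: "p = (t, s)" by (cases p)
  show "\<forall>\<^sub>F q in slice_filter \<beta>. slice_energy f j p \<le> slice_energy f j q"
    using eventually_slice_params_ge[OF p[unfolded ts]] eventually_slice_params
  proof eventually_elim
    case (elim q)
    obtain t' s' where q: "q = (t', s')" by (cases q)
    have "total_energy (f j) j t s \<le> total_energy (f j) j t' s'"
      using elim p unfolding q ts by (intro total_energy_mono[OF f]) (auto simp: slice_params_def)
    then show ?case
      using elim p unfolding q ts by (simp add: slice_energy_eq[of f, OF f] ennreal_leI)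
  qed
qed (rule slice_filter_nontrivial[OF \<beta>])

section \<open>The boundary function\<close>

lemma bdry_tendsto_iff:
  "bdry_tendsto U G A \<longleftrightarrow> (\<forall>l. L2_tendsto cylinder (\<lambda>i. U i l) (G l) A)"
proof
  assume *: "bdry_tendsto U G A"
  show "\<forall>l. L2_tendsto cylinder (\<lambda>i. U i l) (G l) A"
  proof
    fix l
    have lim: "((\<lambda>i. bdry_sq (\<lambda>l p. U i l p - G l p)) \<longlongrightarrow> 0) A"
      using * by (simp add: bdry_tendsto_def)
    have le: "L2_sq cylinder (\<lambda>p. U i l p - G l p) \<le> bdry_sq (\<lambda>l p. U i l p - G l p)" for i
      unfolding bdry_sq_eq_sum
      by (rule member_le_sum[of l UNIV "\<lambda>l. L2_sq cylinder (\<lambda>p. U i l p - G l p)"]) auto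
    have "((\<lambda>i. L2_sq cylinder (\<lambda>p. U i l p - G l p)) \<longlongrightarrow> 0) A"
      by (rule tendsto_sandwich[OF _ _ tendsto_const lim]) (auto simp: le)
    moreover have "\<forall>\<^sub>F i in A. U i l \<in> L2 cylinder"
      using * by (auto simp: bdry_tendsto_def bdry_L2_def elim: eventually_mono)
    ultimately show "L2_tendsto cylinder (\<lambda>i. U i l) (G l) A"
      using * by (simp add: bdry_tendsto_def bdry_L2_def L2_tendsto_def)
  qed
next
  assume *: "\<forall>l. L2_tendsto cylinder (\<lambda>i. U i l) (G l) A"
  have "((\<lambda>i. bdry_sq (\<lambda>l p. U i l p - G l p)) \<longlongrightarrow> (\<Sum>l\<in>(UNIV :: edge set). 0)) A"
    unfolding bdry_sq_eq_sum using * by (intro tendsto_sum) (simp add: L2_tendsto_def)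
  moreover have "\<forall>\<^sub>F i in A. \<forall>l. U i l \<in> L2 cylinder"
    using * by (intro eventually_all_finite) (auto simp: L2_tendsto_def)
  ultimately show "bdry_tendsto U G A"
    using * by (auto simp: bdry_tendsto_def bdry_L2_def L2_tendsto_def)
qed

lemma bdry_tendsto_bdry_sq:
  assumes "bdry_tendsto U G A"
  shows "((\<lambda>i. bdry_sq (U i)) \<longlongrightarrow> bdry_sq G) A"
  unfolding bdry_sq_eq_sum
  using assms unfolding bdry_tendsto_iff by (intro tendsto_sum L2_tendsto_L2_sq) simp

lemma bdry_partial_sum_eq:
  "bdry_partial_sum \<beta> f J l = trig_sum J (bdry_coeff \<beta> f l)"
proof
  fix p :: "real \<times> real"
  obtain x \<theta> where p: "p = (x, \<theta>)" by (cases p)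
  show "bdry_partial_sum \<beta> f J l p = trig_sum J (bdry_coeff \<beta> f l) p"
    by (simp add: bdry_partial_sum_def trig_sum_def bdry_coeff_def slice_radius_def p
        power_int_mult_distrib of_real_power_int mult_ac)
qed

lemma slice_point_in_worm:
  assumes "p \<in> slice_params \<beta>"
  shows "(Complex x (slice_height p l), complex_of_real (slice_radius p l) * cis a) \<in> worm \<beta>"
proof -
  have "ln ((cmod (complex_of_real (slice_radius p l) * cis a))\<^sup>2) = edge_sign l * snd p"
    by (simp add: norm_mult slice_radius_def flip: exp_double)
  then show ?thesis
    using assms slice_radius_pos[of p l]
    by (cases p; cases l) (auto simp: worm_def slice_params_def)
qed

lemma slice_eq:
  "slice F p l (x, \<theta>)
    = F (Complex x (slice_height p l), complex_of_real (slice_radius p l) * cis (2 * pi * \<theta>))"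
  by (cases p; cases l) (simp_all add: slice_radius_def)

lemma slice_has_fourier_series:
  assumes F: "\<And>z1 z2. (z1, z2) \<in> worm \<beta> \<Longrightarrow> ((\<lambda>j. f j z1 * z2 powi j) has_sum F (z1, z2)) UNIV"
    and p: "p \<in> slice_params \<beta>"
  shows "has_fourier_series (slice F p l) (slice_coeff f p l)"
  unfolding has_fourier_series_def
proof (intro allI ballI)
  fix x \<theta> :: real
  show "((\<lambda>j. slice_coeff f p l j x * cis (2 * pi * \<theta>) powi j) has_sum slice F p l (x, \<theta>)) UNIV"
    using F[OF slice_point_in_worm[OF p, of x l "2 * pi * \<theta>"]]
    by (simp add: slice_eq slice_coeff_def power_int_mult_distrib of_real_power_int mult_ac)
qed

theorem proposition3p8:
  fixes \<beta> :: real
    and F :: "complex \<times> complex \<Rightarrow> complex"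
    and f :: "int \<Rightarrow> complex \<Rightarrow> complex"
  assumes "\<beta> > pi / 2"
    and "F \<in> H2_worm \<beta>"
    and "\<And>j. f j \<in> H2_strip \<beta>"
    and "\<And>z1 z2. (z1, z2) \<in> worm \<beta> \<Longrightarrow>
           ((\<lambda>j. f j z1 * z2 powi j) has_sum F (z1, z2)) UNIV"
  shows "bdry_series_converges \<beta> f (bdry_ext \<beta> f) \<and>
         bdry_tendsto (slice F) (bdry_ext \<beta> f)
           (at (pi / 2, \<beta> - pi / 2) within slice_params \<beta>) \<and>
         H2_worm_norm \<beta> F = bdry_norm (bdry_ext \<beta> f)"
proof -
  note \<beta> = assms(1) and f = assms(3)
  have series: "has_fourier_series (slice F p l) (slice_coeff f p l)" if "p \<in> slice_params \<beta>" for p l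
    using assms(4) that by (rule slice_has_fourier_series)
  let ?total = "\<integral>\<^sup>+j. bdry_energy \<beta> f j \<partial>count_space UNIV"
  have slice_sq: "bdry_sq (slice F p) = (\<integral>\<^sup>+j. slice_energy f j p \<partial>count_space UNIV)"
    if p: "p \<in> slice_params \<beta>" for p
  proof -
    have "bdry_sq (slice F p) = (\<Sum>l\<in>UNIV. \<integral>\<^sup>+j. L2_sq lborel (slice_coeff f p l j) \<partial>count_space UNIV)"
      unfolding bdry_sq_eq_sum
      by (intro sum.cong refl parseval_cylinder series[OF p] L2_measurable slice_coeff_L2[of f, OF f p])
    then show ?thesis by (simp add: slice_energy_def nn_integral_sum)
  qed
  have slice_le: "bdry_sq (slice F p) \<le> ?total" if "p \<in> slice_params \<beta>" for p
    unfolding slice_sq[OF that]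
    by (intro nn_integral_mono slice_energy_le_bdry_energy[of f, OF f \<beta> that])
  \<comment> \<open>Finitely many modes converge to their boundary energies, and for every slice they carry at most \<open>\<parallel>F\<parallel>\<^sup>2\<close>.\<close>
  have "?total \<le> H2_worm_sq \<beta> F"
  proof (rule LIMSEQ_le_const2[OF sum_sym_interval_tendsto], intro exI allI impI)
    fix n
    have "((\<lambda>p. \<Sum>j\<in>sym_interval n. slice_energy f j p)
        \<longlongrightarrow> (\<Sum>j\<in>sym_interval n. bdry_energy \<beta> f j)) (slice_filter \<beta>)"
      by (intro tendsto_sum slice_energy_tendsto[of f, OF f \<beta>])
    then show "(\<Sum>j\<in>sym_interval n. bdry_energy \<beta> f j) \<le> H2_worm_sq \<beta> F"
    proof (rule tendsto_upperbound)
      show "\<forall>\<^sub>F p in slice_filter \<beta>. (\<Sum>j\<in>sym_interval n. slice_energy f j p) \<le> H2_worm_sq \<beta> F"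
        using eventually_slice_params
      proof eventually_elim
        case (elim p)
        have "(\<Sum>j\<in>sym_interval n. slice_energy f j p)
            = (\<integral>\<^sup>+j. slice_energy f j p * indicator (sym_interval n) j \<partial>count_space UNIV)"
          by (subst nn_integral_count_space'[of "sym_interval n"]) (auto intro!: sum.cong)
        also have "\<dots> \<le> bdry_sq (slice F p)"
          unfolding slice_sq[OF elim] by (intro nn_integral_mono) (auto split: split_indicator)
        also have "\<dots> \<le> H2_worm_sq \<beta> F"
          unfolding H2_worm_sq_def using elim by (rule SUP_upper)
        finally show ?case .
      qed
    qed (rule slice_filter_nontrivial[OF \<beta>])
  qed
  moreover have "H2_worm_sq \<beta> F < \<infinity>" using assms(2) by (simp add: H2_worm_def)
  ultimately have total_finite: "?total < \<infinity>" by (rule le_less_trans)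
  have bdry_coeff_L2: "bdry_coeff \<beta> f l j \<in> L2 lborel" for l j
    using slice_coeff_tendsto[of f, OF f \<beta>] by (simp add: L2_tendsto_def)
  have bdry_coeff_le: "L2_sq lborel (bdry_coeff \<beta> f l j) \<le> bdry_energy \<beta> f j" for l j
    unfolding bdry_energy_def by (rule member_le_sum) auto
  have "\<exists>G. L2_tendsto cylinder (\<lambda>J. trig_sum J (bdry_coeff \<beta> f l)) G (finite_subsets_at_top UNIV)" for l
  proof (rule trig_sum_convergent[OF bdry_coeff_L2])
    show "(\<integral>\<^sup>+j. L2_sq lborel (bdry_coeff \<beta> f l j) \<partial>count_space UNIV) < \<infinity>"
      by (rule le_less_trans[OF nn_integral_mono total_finite]) (rule bdry_coeff_le)
  qed
  then obtain G where "\<And>l. L2_tendsto cylinder (\<lambda>J. trig_sum J (bdry_coeff \<beta> f l)) (G l)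
      (finite_subsets_at_top UNIV)"
    by metis
  then have "bdry_series_converges \<beta> f G"
    unfolding bdry_series_converges_def bdry_tendsto_iff bdry_partial_sum_eq by blast
  then have ext: "bdry_series_converges \<beta> f (bdry_ext \<beta> f)"
    unfolding bdry_ext_def by (rule someI[where P = "bdry_series_converges \<beta> f"])
  have conv: "bdry_tendsto (slice F) (bdry_ext \<beta> f) (slice_filter \<beta>)"
    unfolding bdry_tendsto_iff
  proof
    fix l
    show "L2_tendsto cylinder (\<lambda>p. slice F p l) (bdry_ext \<beta> f l) (slice_filter \<beta>)"
    proof (rule fourier_series_dominated_convergence)
      show "\<forall>\<^sub>F p in slice_filter \<beta>. has_fourier_series (slice F p l) (slice_coeff f p l) \<and>
          (\<forall>j. slice_coeff f p l j \<in> L2 lborel \<and>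
            L2_sq lborel (slice_coeff f p l j) \<le> bdry_energy \<beta> f j)"
        using eventually_slice_params
      proof eventually_elim
        case (elim p)
        have "L2_sq lborel (slice_coeff f p l j) \<le> bdry_energy \<beta> f j" for j
        proof -
          have "L2_sq lborel (slice_coeff f p l j) \<le> slice_energy f j p"
            unfolding slice_energy_def by (rule member_le_sum) auto
          also have "\<dots> \<le> bdry_energy \<beta> f j"
            by (rule slice_energy_le_bdry_energy[of f, OF f \<beta> elim])
          finally show ?thesis .
        qed
        then show ?case by (simp add: series[OF elim] slice_coeff_L2[of f, OF f elim])
      qed
      show "L2_tendsto lborel (\<lambda>p. slice_coeff f p l j) (bdry_coeff \<beta> f l j) (slice_filter \<beta>)" for j
        by (rule slice_coeff_tendsto[of f, OF f \<beta>])
      show "L2_tendsto cylinder (\<lambda>J. trig_sum J (bdry_coeff \<beta> f l)) (bdry_ext \<beta> f l)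
          (finite_subsets_at_top UNIV)"
        using ext unfolding bdry_series_converges_def bdry_tendsto_iff bdry_partial_sum_eq by blast
    qed (rule total_finite)
  qed
  have "bdry_sq (bdry_ext \<beta> f) = H2_worm_sq \<beta> F"
  proof (rule antisym)
    show "bdry_sq (bdry_ext \<beta> f) \<le> H2_worm_sq \<beta> F"
    proof (rule tendsto_upperbound[OF bdry_tendsto_bdry_sq[OF conv]])
      show "\<forall>\<^sub>F p in slice_filter \<beta>. bdry_sq (slice F p) \<le> H2_worm_sq \<beta> F"
        using eventually_slice_params
        by eventually_elim (auto simp: H2_worm_sq_def intro: SUP_upper)
    qed (rule slice_filter_nontrivial[OF \<beta>])
    have "((\<lambda>J. bdry_sq (bdry_partial_sum \<beta> f J)) \<longlongrightarrow> bdry_sq (bdry_ext \<beta> f))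
        (finite_subsets_at_top UNIV)"
      using ext unfolding bdry_series_converges_def by (rule bdry_tendsto_bdry_sq)
    from filterlim_compose[OF this filterlim_sym_interval]
    have "(\<lambda>n. bdry_sq (bdry_partial_sum \<beta> f (sym_interval n))) \<longlonglongrightarrow> bdry_sq (bdry_ext \<beta> f)" .
    moreover have "bdry_sq (bdry_partial_sum \<beta> f (sym_interval n))
        = (\<Sum>j\<in>sym_interval n. bdry_energy \<beta> f j)" for n
    proof -
      have "L2_sq cylinder (trig_sum (sym_interval n) (bdry_coeff \<beta> f l))
          = (\<Sum>j\<in>sym_interval n. L2_sq lborel (bdry_coeff \<beta> f l j))" for l
        by (intro L2_sq_trig_sum L2_measurable bdry_coeff_L2) simp
      then show ?thesis
        unfolding bdry_sq_eq_sum bdry_partial_sum_eq bdry_energy_def by (simp add: sum.swap[of _ UNIV])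
    qed
    ultimately have "bdry_sq (bdry_ext \<beta> f) = ?total"
      using LIMSEQ_unique[OF _ sum_sym_interval_tendsto] by simp
    then show "H2_worm_sq \<beta> F \<le> bdry_sq (bdry_ext \<beta> f)"
      unfolding H2_worm_sq_def by (auto intro!: SUP_least slice_le)
  qed
  then show ?thesis
    using ext conv by (simp add: H2_worm_norm_def bdry_norm_def)
qed

end
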